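(* There is an absolute constant $c>0$ such that the following holds. Let $q$ be a prime power and let $A,B,C\subset\mathbb{F}_q^n$ be nonempty sets of densities $\alpha,\beta,\gamma$. Then $A+B+C$ contains $X+V$, where $X\subset B$ has $|X|\ge0.99|B|$ and $V$ is an affine subspace of dimension at least \[ \left(\frac{c\,n}{\log^3(2/\alpha\gamma)}-\log(1/\beta)\right)\Big/\log q. \]
   Context: Density of $X\subset\mathbb{F}_q^n$ means $|X|/q^n$. $A+B+C=\{a+b+c\}$ and $X+V=\{x+v:x\in X,v\in V\}$.
   Formalization: The dimension bound is rounded down to an integer, since unrounded it fails (n=1, A=C={0}, B the nonzero elements, q large: the bound is positive but A+B+C=B contains no translate of the line); the field with q elements is taken with natural numbers as its elements. *)

theory Defs
  imports Complex_Main "HOL-Number_Theory.Prime_Powers" "HOL-Algebra.AbelCoset"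
    "Jordan_Normal_Form.Missing_VectorSpace"
begin

text \<open>
  The constant in the theorem is uniform over all finite fields and all dimensions, and types
  cannot be quantified inside a formula. Hence the field is a record (in the sense of HOL-Algebra)
  and its \<open>n\<close>-th power is the module record of functions on \<open>{..<n}\<close>. The \<open>mult\<close> and \<open>one\<close>
  fields, which every module record carries, play no role.

  The dimension bound in the theorem is rounded down, because without rounding the
  theorem is false: with \<open>n = 1\<close>, \<open>A = C = {0}\<close> and
  \<open>B\<close> the set of nonzero elements, the bound is positive for every large \<open>q\<close>, whatever the
  absolute constant \<open>c > 0\<close>, but no translate of a line fits into \<open>A + B + C = B\<close>.
\<close>

definition coord_space ::
    "('a, 'm) ring_scheme \<Rightarrow> nat \<Rightarrow> ('a, nat \<Rightarrow> 'a) module" where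
  "coord_space F n =
     \<lparr>carrier = {..<n} \<rightarrow>\<^sub>E carrier F,
      mult = undefined, one = undefined,
      zero = (\<lambda>i\<in>{..<n}. \<zero>\<^bsub>F\<^esub>),
      add = (\<lambda>u v. \<lambda>i\<in>{..<n}. u i \<oplus>\<^bsub>F\<^esub> v i),
      smult = (\<lambda>a u. \<lambda>i\<in>{..<n}. a \<otimes>\<^bsub>F\<^esub> u i)\<rparr>"

definition set_density :: "('a, 'm) ring_scheme \<Rightarrow> nat \<Rightarrow> (nat \<Rightarrow> 'a) set \<Rightarrow> real" where
  "set_density F n X = real (card X) / real (card (carrier F)) ^ n"

definition affine_subspace_of_dim ::
    "('a, 'm) ring_scheme \<Rightarrow> ('a, 'b, 'e) module_scheme \<Rightarrow> nat \<Rightarrow> 'b set \<Rightarrow> bool" where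
  "affine_subspace_of_dim F M d V \<longleftrightarrow>
     (\<exists>W. \<exists>v\<in>carrier M. VectorSpace.subspace F W M \<and> V = W +>\<^bsub>M\<^esub> v \<and>
        vectorspace.dim F (M\<lparr>carrier := W\<rparr>) = d)"

lemma coord_space_vectorspace:
  fixes F (structure)
  assumes "field F"
  shows "vectorspace F (coord_space F n)"
proof -
  interpret field F by fact
  have ag: "abelian_group (coord_space F n)"
  proof (rule abelian_groupI)
    fix x assume x: "x \<in> carrier (coord_space F n)"
    show "\<exists>y\<in>carrier (coord_space F n). y \<oplus>\<^bsub>coord_space F n\<^esub> x = \<zero>\<^bsub>coord_space F n\<^esub>"
      by (rule bexI[where x = "\<lambda>i\<in>{..<n}. \<ominus> x i"])
        (use x in \<open>auto simp: coord_space_def PiE_iff l_neg intro!: restrict_ext\<close>)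
  qed (auto simp: coord_space_def PiE_iff a_ac extensional_def intro!: ext)
  have "module F (coord_space F n)"
    by (rule moduleI[OF is_cring ag])
      (auto simp: coord_space_def PiE_iff l_distr r_distr m_assoc extensional_def intro!: ext)
  then show ?thesis
    using assms by (simp add: vectorspace_def)
qed

end

theory Submission
  imports Defs "HOL-Algebra.Multiplicative_Group"
begin

text \<open>
  Choose \<open>t\<close> such that \<open>A' = A \<inter> (t - C)\<close> has density at least \<open>\<alpha>\<gamma>\<close>, and let \<open>f x\<close> be the
  probability that \<open>x - a\<close> lies in \<open>B + C\<close> for random \<open>a\<close> in \<open>A'\<close>. Then \<open>f\<close> equals 1 on \<open>B + t\<close>
  and vanishes off \<open>A + B + C\<close>. Approximating \<open>f\<close> by the average of \<open>k\<close> random translates of the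
  indicator of \<open>B + C\<close> gives, as in the Croot--Sisask lemma, a set \<open>T\<close> of density about
  \<open>(\<alpha>\<gamma>)\<^sup>k\<close> of almost periods of \<open>f\<close>. Let \<open>F\<close> be the \<open>l\<close>-fold average of \<open>f\<close> over \<open>T\<close>, with \<open>l\<close>
  of order \<open>L = log (2/\<alpha>\<gamma>)\<close>. Off a set of density \<open>exp (- \<Omega> (k / l\<^sup>2))\<close> it is close to \<open>f\<close>, and by
  Parseval it is almost invariant under the annihilator of the large spectrum of \<open>T\<close>, whose
  codimension is \<open>O (k L)\<close> by Chang's bound. Taking \<open>k\<close> of order \<open>n / L\<close> leaves an annihilator of
  dimension at least \<open>n / 2\<close>. A union bound over a subspace \<open>W\<close> of it costs a factor \<open>|W|\<close>, so
  almost every \<open>x\<close> in \<open>B\<close> has \<open>f > 0\<close> on all of \<open>x + t + W\<close> as long as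
  \<open>|W| \<le> c \<beta> exp (\<Omega> (n / L\<^sup>3))\<close>.
\<close>

section \<open>Averages\<close>

definition avg :: "'a set \<Rightarrow> ('a \<Rightarrow> 'b::real_normed_field) \<Rightarrow> 'b" where
  "avg A f = sum f A / of_nat (card A)"

lemma avg_cong: "(\<And>x. x \<in> A \<Longrightarrow> f x = g x) \<Longrightarrow> avg A f = avg A g"
  unfolding avg_def by (simp cong: sum.cong)

lemma avg_add: "avg A (\<lambda>x. f x + g x) = avg A f + avg A g"
  by (simp add: avg_def sum.distrib add_divide_distrib)

lemma avg_diff: "avg A (\<lambda>x. f x - g x) = avg A f - avg A g"
  by (simp add: avg_def sum_subtractf diff_divide_distrib)

lemma avg_cmult: "avg A (\<lambda>x. c * f x) = c * avg A f"
  by (simp add: avg_def sum_distrib_left)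

lemma avg_const: "finite A \<Longrightarrow> A \<noteq> {} \<Longrightarrow> avg A (\<lambda>x. c) = c"
  by (simp add: avg_def)

lemma avg_mono:
  fixes f g :: "'a \<Rightarrow> real"
  shows "(\<And>x. x \<in> A \<Longrightarrow> f x \<le> g x) \<Longrightarrow> avg A f \<le> avg A g"
  unfolding avg_def by (intro divide_right_mono sum_mono) auto

lemma avg_le_const:
  fixes f :: "'a \<Rightarrow> real"
  shows "finite A \<Longrightarrow> A \<noteq> {} \<Longrightarrow> (\<And>x. x \<in> A \<Longrightarrow> f x \<le> c) \<Longrightarrow> avg A f \<le> c"
  using avg_mono[of A f "\<lambda>_. c"] by (simp add: avg_const)

lemma avg_ge_const:
  fixes f :: "'a \<Rightarrow> real"
  shows "finite A \<Longrightarrow> A \<noteq> {} \<Longrightarrow> (\<And>x. x \<in> A \<Longrightarrow> c \<le> f x) \<Longrightarrow> c \<le> avg A f"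
  using avg_mono[of A "\<lambda>_. c" f] by (simp add: avg_const)

lemma avg_swap: "avg A (\<lambda>x. avg B (\<lambda>y. f x y)) = avg B (\<lambda>y. avg A (\<lambda>x. f x y))"
  unfolding avg_def sum_divide_distrib[symmetric] by (subst sum.swap) (simp add: mult.commute)

text \<open>Jensen: the tangent line to \<open>exp\<close> at the mean \<open>m\<close> lies below
  the graph, and its average is exactly \<open>exp m\<close>.\<close>

lemma exp_avg_le:
  fixes u :: "'a \<Rightarrow> real"
  assumes "finite A" "A \<noteq> {}"
  shows "exp (avg A u) \<le> avg A (\<lambda>a. exp (u a))"
proof -
  define m where "m = avg A u"
  have "exp m * (1 - m) + exp m * u a \<le> exp (u a)" for a
  proof -
    have "exp m * (1 + (u a - m)) \<le> exp m * exp (u a - m)"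
      by (intro mult_left_mono exp_ge_add_one_self) auto
    then show ?thesis
      by (simp add: exp_add[symmetric] algebra_simps)
  qed
  then have "avg A (\<lambda>a. exp m * (1 - m) + exp m * u a) \<le> avg A (\<lambda>a. exp (u a))"
    by (rule avg_mono)
  moreover have "avg A (\<lambda>a. exp m * (1 - m) + exp m * u a) = exp m"
    unfolding avg_add avg_cmult avg_const[OF assms] m_def[symmetric] by (simp add: algebra_simps)
  ultimately show ?thesis by (simp add: m_def)
qed

lemma abs_avg_le:
  fixes u :: "'a \<Rightarrow> real"
  shows "\<bar>avg A u\<bar> \<le> avg A (\<lambda>a. \<bar>u a\<bar>)"
  by (simp add: avg_def divide_right_mono)

lemma exp_abs_avg_le:
  fixes u :: "'a \<Rightarrow> real"
  assumes "finite A" "A \<noteq> {}" "0 \<le> \<theta>"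
  shows "exp (\<theta> * \<bar>avg A u\<bar>) \<le> avg A (\<lambda>a. exp (\<theta> * \<bar>u a\<bar>))"
proof -
  have "exp (\<theta> * \<bar>avg A u\<bar>) \<le> exp (avg A (\<lambda>a. \<theta> * \<bar>u a\<bar>))"
    using abs_avg_le[of A u] assms(3) by (simp add: avg_cmult mult_left_mono)
  also have "\<dots> \<le> avg A (\<lambda>a. exp (\<theta> * \<bar>u a\<bar>))"
    by (rule exp_avg_le) fact+
  finally show ?thesis .
qed

text \<open>Nonnegativity of the variance: average \<open>(u a - m)^2 \<ge> 0\<close>, where
  \<open>m\<close> is the mean.\<close>

lemma avg_square_le:
  fixes u :: "'a \<Rightarrow> real"
  assumes "finite A" "A \<noteq> {}"
  shows "(avg A u)\<^sup>2 \<le> avg A (\<lambda>a. (u a)\<^sup>2)"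
proof -
  define m where "m = avg A u"
  have "avg A (\<lambda>a. 2 * m * u a - m\<^sup>2) \<le> avg A (\<lambda>a. (u a)\<^sup>2)"
  proof (rule avg_mono)
    fix a show "2 * m * u a - m\<^sup>2 \<le> (u a)\<^sup>2"
      using sum_squares_ge_zero[of "u a - m" 0] by (simp add: power2_eq_square algebra_simps)
  qed
  then show ?thesis
    using assms by (simp add: avg_diff avg_cmult avg_const m_def[symmetric] power2_eq_square)
qed

lemma exp_le_quadratic:
  fixes u :: real
  assumes "\<bar>u\<bar> \<le> 1"
  shows "exp u \<le> 1 + u + u\<^sup>2"
proof (cases "u \<ge> 0")
  case True
  then show ?thesis using exp_bound[of u] assms by auto
next
  case False
  define v where "v = - u"
  have v: "0 \<le> v" "v \<le> 1" using False assms by (auto simp: v_def)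
  have "1 + v + v\<^sup>2 / 2 \<le> exp v" using exp_lower_Taylor_quadratic[of v] v by simp
  \<comment> \<open>For negative \<open>u\<close> the quadratic lower bound for \<open>exp v\<close>
    is inverted: its product with \<open>1 - v + v^2\<close> is still at least 1.\<close>
  have "1 \<le> (1 + v + v\<^sup>2 / 2) * (1 - v + v\<^sup>2)"
  proof -
    have "(1 + v + v\<^sup>2 / 2) * (1 - v + v\<^sup>2) = 1 + v\<^sup>2/2 + v^3/2 + v^4/2"
      by (simp add: power2_eq_square power3_eq_cube power4_eq_xxxx field_simps)
    then show ?thesis using v by simp
  qed
  also have "\<dots> \<le> exp v * (1 - v + v\<^sup>2)"
    using \<open>1 + v + v\<^sup>2 / 2 \<le> exp v\<close> v by (intro mult_right_mono) auto
  finally have "exp (- v) \<le> 1 - v + v\<^sup>2"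
    by (simp add: exp_minus field_simps)
  then show ?thesis by (simp add: v_def)
qed

text \<open>A Hoeffding-type bound: \<open>1 + u + u^2\<close> dominates \<open>exp u\<close>, the
  linear term averages to zero, and \<open>1 + b^2 \<le> exp (b^2)\<close>.\<close>

lemma avg_exp_le:
  fixes u :: "'a \<Rightarrow> real"
  assumes "finite A" "A \<noteq> {}" "avg A u = 0" "\<And>a. a \<in> A \<Longrightarrow> \<bar>u a\<bar> \<le> b" "b \<le> 1"
  shows "avg A (\<lambda>a. exp (u a)) \<le> exp (b\<^sup>2)"
proof -
  have "avg A (\<lambda>a. exp (u a)) \<le> avg A (\<lambda>a. (1 + b\<^sup>2) + u a)"
  proof (rule avg_mono)
    fix a assume a: "a \<in> A"
    have "exp (u a) \<le> 1 + u a + (u a)\<^sup>2"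
      using assms(4)[OF a] assms(5) by (intro exp_le_quadratic) auto
    moreover have "(u a)\<^sup>2 \<le> b\<^sup>2"
      using assms(4)[OF a] by (intro abs_le_square_iff[THEN iffD1]) auto
    ultimately show "exp (u a) \<le> (1 + b\<^sup>2) + u a" by simp
  qed
  also have "\<dots> = 1 + b\<^sup>2" using assms(1,2,3) by (simp add: avg_add avg_const)
  also have "\<dots> \<le> exp (b\<^sup>2)" by (rule exp_ge_add_one_self)
  finally show ?thesis .
qed

text \<open>Independence: a uniform random element of \<open>I \<rightarrow>\<^sub>E A\<close> has
  independent uniform coordinates, so the expectation of a product factors.\<close>

lemma avg_PiE_prod:
  fixes u :: "'a \<Rightarrow> real"
  assumes "finite A" "finite I"
  shows "avg (I \<rightarrow>\<^sub>E A) (\<lambda>a. \<Prod>i\<in>I. u (a i)) = (avg A u) ^ card I"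
  using assms prod_sum_PiE[of I "\<lambda>_. A" "\<lambda>_. u"]
  by (simp add: avg_def power_divide card_PiE)

text \<open>Markov's inequality at twice the bound on the mean; it will show that at least half of
  all random samples are good.\<close>

lemma card_ge_half_of_avg_le:
  fixes u :: "'a \<Rightarrow> real"
  assumes "finite A" "\<And>a. a \<in> A \<Longrightarrow> 0 \<le> u a" "avg A u \<le> K" "0 < K"
  shows "real (card A) \<le> 2 * real (card {a \<in> A. u a \<le> 2 * K})"
proof (cases "A = {}")
  case False
  let ?B = "{a \<in> A. \<not> u a \<le> 2 * K}"
  have "2 * K * card ?B = (\<Sum>a\<in>?B. 2 * K)" by simp
  also have "\<dots> \<le> sum u ?B" by (intro sum_mono) auto
  also have "\<dots> \<le> sum u A" using assms by (intro sum_mono2) auto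
  also have "\<dots> \<le> K * card A"
    using assms(1,3) False by (simp add: avg_def field_simps card_gt_0_iff)
  finally have "2 * real (card ?B) \<le> card A" using assms(4) by simp
  moreover have "card A = card {a \<in> A. u a \<le> 2 * K} + card ?B"
    using assms(1) by (subst card_Un_disjoint[symmetric]) (auto intro: arg_cong[where f = card])
  ultimately show ?thesis by simp
qed simp

section \<open>Almost periods\<close>

locale finite_abelian_group = abelian_group G for G (structure) +
  assumes finite_carrier [simp]: "finite (carrier G)"
begin

section \<open>Translations, smoothing and exponential moments on a finite abelian group\<close>

lemma carrier_nonempty [simp]: "carrier G \<noteq> {}"
  using zero_closed by blast

lemma card_carrier_pos: "card (carrier G) > 0"
  by (simp add: card_gt_0_iff)

lemma bij_betw_translate:
  assumes "y \<in> carrier G"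
  shows "bij_betw (\<lambda>x. x \<oplus> y) (carrier G) (carrier G)"
  by (rule bij_betwI[where g = "\<lambda>x. x \<ominus> y"]) (use assms in \<open>auto simp: a_minus_def a_assoc l_neg r_neg\<close>)

lemma sum_translate:
  assumes "y \<in> carrier G"
  shows "(\<Sum>x\<in>carrier G. h (x \<oplus> y)) = sum h (carrier G)"
  using sum.reindex_bij_betw[OF bij_betw_translate[OF assms]] .

lemma avg_translate:
  assumes "y \<in> carrier G"
  shows "avg (carrier G) (\<lambda>x. h (x \<oplus> y)) = avg (carrier G) h"
  by (simp add: avg_def sum_translate assms)

text \<open>Convolution with the uniform measure on \<open>-T\<close>. Its iterates average
  \<open>g\<close> over random sums of elements of \<open>T\<close>.\<close>

definition smooth :: "'a set \<Rightarrow> ('a \<Rightarrow> real) \<Rightarrow> 'a \<Rightarrow> real" where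
  "smooth T g x = avg T (\<lambda>t. g (x \<oplus> t))"

text \<open>For \<open>\<theta> \<ge> 0\<close> this moment is convex in \<open>g\<close> and
  invariant under translation, so averaging translates never increases it.\<close>

definition exp_mean :: "real \<Rightarrow> ('a \<Rightarrow> real) \<Rightarrow> real" where
  "exp_mean \<theta> g = avg (carrier G) (\<lambda>x. exp (\<theta> * \<bar>g x\<bar>))"

text \<open>Jensen at each point \<open>x\<close>, followed by an interchange of the two
  averages.\<close>

lemma exp_mean_avg_le:
  assumes "finite I" "I \<noteq> {}" "0 \<le> \<theta>" "\<And>i. i \<in> I \<Longrightarrow> exp_mean \<theta> (g i) \<le> K"
  shows "exp_mean \<theta> (\<lambda>x. avg I (\<lambda>i. g i x)) \<le> K"
proof -
  have "exp_mean \<theta> (\<lambda>x. avg I (\<lambda>i. g i x)) \<le> avg (carrier G) (\<lambda>x. avg I (\<lambda>i. exp (\<theta> * \<bar>g i x\<bar>)))"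
    unfolding exp_mean_def by (intro avg_mono exp_abs_avg_le assms)
  also have "\<dots> = avg I (\<lambda>i. exp_mean \<theta> (g i))"
    unfolding exp_mean_def by (rule avg_swap)
  also have "\<dots> \<le> K"
    by (intro avg_le_const assms)
  finally show ?thesis .
qed

lemma exp_mean_translate:
  assumes "y \<in> carrier G"
  shows "exp_mean \<theta> (\<lambda>x. g (x \<oplus> y)) = exp_mean \<theta> g"
  unfolding exp_mean_def by (rule avg_translate[OF assms])

lemma exp_mean_cong:
  assumes "\<And>x. x \<in> carrier G \<Longrightarrow> g x = h x"
  shows "exp_mean \<theta> g = exp_mean \<theta> h"
  unfolding exp_mean_def using assms by (simp cong: avg_cong)

lemma exp_mean_smooth_le:
  assumes "T \<subseteq> carrier G" "T \<noteq> {}" "0 \<le> \<theta>"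
  shows "exp_mean \<theta> (smooth T g) \<le> exp_mean \<theta> g"
proof -
  have "exp_mean \<theta> (\<lambda>x. avg T (\<lambda>t. g (x \<oplus> t))) \<le> exp_mean \<theta> g"
    using assms finite_subset[OF assms(1)]
    by (intro exp_mean_avg_le) (auto simp: exp_mean_translate)
  then show ?thesis by (simp add: smooth_def[abs_def])
qed

lemma exp_mean_smooth_pow_le:
  assumes "T \<subseteq> carrier G" "T \<noteq> {}" "0 \<le> \<theta>"
  shows "exp_mean \<theta> ((smooth T ^^ j) g) \<le> exp_mean \<theta> g"
proof (induction j)
  case (Suc j)
  then show ?case using exp_mean_smooth_le[OF assms, of "(smooth T ^^ j) g"] by simp
qed simp

lemma smooth_diff: "smooth T (\<lambda>x. g x - h x) = (\<lambda>x. smooth T g x - smooth T h x)"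
  by (simp add: smooth_def fun_eq_iff avg_diff)

lemma smooth_pow_diff:
  "(smooth T ^^ j) (\<lambda>x. g x - h x) = (\<lambda>x. (smooth T ^^ j) g x - (smooth T ^^ j) h x)"
  by (induction j) (simp_all add: smooth_diff)

text \<open>Telescoping writes the difference as the sum over \<open>j < l\<close> of the
  \<open>j\<close>-fold smoothing of \<open>D\<close>, that is, \<open>l\<close> times an average.
  Dividing \<open>\<theta>\<close> by \<open>l\<close> absorbs the factor, and the bound
  \<open>K\<close> survives unchanged.\<close>

lemma exp_mean_smooth_pow_diff_le:
  assumes T: "T \<subseteq> carrier G" "T \<noteq> {}" and \<theta>: "0 \<le> \<theta>" and l: "l > 0"
    and K: "\<And>t. t \<in> T \<Longrightarrow> exp_mean \<theta> (\<lambda>x. f (x \<oplus> t) - f x) \<le> K"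
  shows "exp_mean (\<theta> / l) (\<lambda>x. (smooth T ^^ l) f x - f x) \<le> K"
proof -
  have finT: "finite T" using T(1) finite_carrier by (rule finite_subset)
  define D where "D = (\<lambda>x. smooth T f x - f x)"
  have "D = (\<lambda>x. avg T (\<lambda>t. f (x \<oplus> t) - f x))"
    using finT T by (auto simp: D_def smooth_def avg_diff avg_const)
  then have D: "exp_mean \<theta> D \<le> K"
    using exp_mean_avg_le[OF finT T(2) \<theta>, of "\<lambda>t x. f (x \<oplus> t) - f x"] K by simp
  have step: "(smooth T ^^ j) D x = (smooth T ^^ Suc j) f x - (smooth T ^^ j) f x" for j x
    unfolding D_def smooth_pow_diff by (simp only: funpow_Suc_right o_apply)
  have "(smooth T ^^ l) f x - f x = (\<Sum>j<l. (smooth T ^^ j) D x)" for x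
    unfolding step using sum_lessThan_telescope[of "\<lambda>j. (smooth T ^^ j) f x" l] by simp
  then have eq: "(smooth T ^^ l) f x - f x = l * avg {..<l} (\<lambda>j. (smooth T ^^ j) D x)" for x
    using l by (simp add: avg_def)
  have "exp_mean (\<theta> / l) (\<lambda>x. (smooth T ^^ l) f x - f x)
    = exp_mean \<theta> (\<lambda>x. avg {..<l} (\<lambda>j. (smooth T ^^ j) D x))"
    unfolding eq using l by (simp add: exp_mean_def abs_mult)
  also have "\<dots> \<le> K"
    using l by (intro exp_mean_avg_le \<theta> order.trans[OF exp_mean_smooth_pow_le[OF T \<theta>] D]) auto
  finally show ?thesis .
qed

text \<open>Markov's inequality for the exponential moment.\<close>

lemma card_exceed_le:
  assumes "exp_mean \<theta> h \<le> K" "0 \<le> \<theta>"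
  shows "real (card {x \<in> carrier G. \<bar>h x\<bar> > s}) \<le> K * exp (- \<theta> * s) * card (carrier G)"
proof -
  let ?E = "{x \<in> carrier G. \<bar>h x\<bar> > s}"
  have "card ?E * exp (\<theta> * s) = (\<Sum>x\<in>?E. exp (\<theta> * s))" by simp
  also have "\<dots> \<le> (\<Sum>x\<in>?E. exp (\<theta> * \<bar>h x\<bar>))"
    using assms(2) by (intro sum_mono) (auto intro: mult_left_mono)
  also have "\<dots> \<le> (\<Sum>x\<in>carrier G. exp (\<theta> * \<bar>h x\<bar>))"
    by (intro sum_mono2) auto
  also have "\<dots> \<le> K * card (carrier G)"
    using assms(1) card_carrier_pos by (simp add: exp_mean_def avg_def field_simps)
  finally show ?thesis by (simp add: exp_minus field_simps)
qed

text \<open>The exponential-moment form of the Croot--Sisask lemma: sampling the convolution with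
  \<open>k\<close> random elements of \<open>A\<close>, and pigeonholing the good samples into one class modulo diagonal
  translations. Exponential moments (rather than \<open>L\<^sup>p\<close> norms or tail bounds) cost nothing
  when almost periods are added up.\<close>

lemma almost_periods:
  fixes g :: "'a \<Rightarrow> real" and k :: nat and \<mu> :: real
  assumes A: "A \<subseteq> carrier G" "A \<noteq> {}" and g: "\<And>x. 0 \<le> g x" "\<And>x. g x \<le> 1"
    and lam: "0 \<le> \<mu>" "\<mu> \<le> k" and k: "k > 0"
  defines "f \<equiv> \<lambda>x. avg A (\<lambda>a. g (x \<ominus> a))"
  shows "\<exists>T \<subseteq> carrier G. T \<noteq> {} \<and>
    (card A / card (carrier G)) ^ k * card (carrier G) \<le> 2 * real (card T) \<and>
    (\<forall>t\<in>T. exp_mean (\<mu> / 2) (\<lambda>x. f (x \<oplus> t) - f x) \<le> 4 * exp (\<mu>\<^sup>2 / k))"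
proof -
  let ?G = "carrier G" and ?I = "{..<k}"
  have finA: "finite A" using A(1) finite_carrier by (rule finite_subset)
  \<comment> \<open>The empirical version of \<open>f\<close> for the sample \<open>a\<close>, an
    element of \<open>A^k\<close>.\<close>
  define h where "h = (\<lambda>a x. avg ?I (\<lambda>i. g (x \<ominus> a i)))"
  define u where "u = (\<lambda>a. exp_mean \<mu> (\<lambda>x. h a x - f x))"
  define P where "P = ?I \<rightarrow>\<^sub>E A"
  have finP: "finite P" by (simp add: P_def finA finite_PiE)
  have P_ne: "P \<noteq> {}" using A by (simp add: P_def PiE_eq_empty_iff)
  \<comment> \<open>The good samples. The average of \<open>u\<close> over all samples will be at
    most \<open>2 * exp (\<mu>^2 / k)\<close>; the further factor 2 is for Markov.\<close>
  define D where "D = {a \<in> P. u a \<le> 2 * (2 * exp (\<mu>\<^sup>2 / k))}"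

  \<comment> \<open>By independence the moment is the \<open>k\<close>-th power of a one-sample
    moment, whose exponent has mean zero and size at most \<open>\<mu> / k \<le> 1\<close>. Both
    signs of \<open>\<sigma>\<close> are needed, since the absolute value is bounded below through
    the sum of two exponentials.\<close>
  have signed: "avg P (\<lambda>a. exp (\<sigma> * (h a x - f x))) \<le> exp (\<mu>\<^sup>2 / k)" if "\<bar>\<sigma>\<bar> = \<mu>" for \<sigma> x
  proof -
    have hd: "h a x - f x = avg ?I (\<lambda>i. g (x \<ominus> a i) - f x)" for a
      using k by (simp add: h_def avg_diff avg_const lessThan_empty_iff)
    have "exp (\<sigma> * (h a x - f x)) = (\<Prod>i\<in>?I. exp (\<sigma> / k * (g (x \<ominus> a i) - f x)))" for a
      unfolding hd by (simp add: avg_def exp_sum[symmetric] sum_distrib_left mult.commute sum_divide_distrib)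
    then have "avg P (\<lambda>a. exp (\<sigma> * (h a x - f x)))
      = avg A (\<lambda>a. exp (\<sigma> / k * (g (x \<ominus> a) - f x))) ^ k"
      using avg_PiE_prod[OF finA, of ?I "\<lambda>a. exp (\<sigma> / k * (g (x \<ominus> a) - f x))"]
      by (simp add: P_def)
    also have "\<dots> \<le> exp ((\<mu> / k)\<^sup>2) ^ k"
    proof (intro power_mono avg_exp_le finA A)
      show "avg A (\<lambda>a. \<sigma> / k * (g (x \<ominus> a) - f x)) = 0"
        unfolding avg_cmult avg_diff using finA A by (simp add: f_def avg_const)
      have f01: "0 \<le> f x" "f x \<le> 1"
        using finA A g unfolding f_def by (auto intro: avg_ge_const avg_le_const)
      fix a
      have "\<bar>g (x \<ominus> a) - f x\<bar> \<le> 1" using f01 g[of "x \<ominus> a"] by linarith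
      then show "\<bar>\<sigma> / k * (g (x \<ominus> a) - f x)\<bar> \<le> \<mu> / k"
        using that k lam mult_left_mono[of "\<bar>g (x \<ominus> a) - f x\<bar>" 1 "\<mu> / k"] by (simp add: abs_mult)
      show "\<mu> / k \<le> 1" using lam k by simp
      show "0 \<le> avg A (\<lambda>a. exp (\<sigma> / k * (g (x \<ominus> a) - f x)))"
        using finA A by (intro avg_ge_const) auto
    qed
    also have "\<dots> = exp (\<mu>\<^sup>2 / k)"
      using k by (simp add: exp_of_nat_mult[symmetric] power2_eq_square)
    finally show ?thesis .
  qed
  have "avg P (\<lambda>a. exp (\<mu> * \<bar>h a x - f x\<bar>)) \<le> 2 * exp (\<mu>\<^sup>2 / k)" for x
  proof -
    have "avg P (\<lambda>a. exp (\<mu> * \<bar>h a x - f x\<bar>))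
      \<le> avg P (\<lambda>a. exp (\<mu> * (h a x - f x)) + exp (- \<mu> * (h a x - f x)))"
      by (rule avg_mono) (auto simp: abs_if right_diff_distrib)
    also have "\<dots> \<le> 2 * exp (\<mu>\<^sup>2 / k)"
      unfolding avg_add using signed[of \<mu> x] signed[of "- \<mu>" x] lam by simp
    finally show ?thesis .
  qed
  then have "avg P u \<le> 2 * exp (\<mu>\<^sup>2 / k)"
    unfolding u_def exp_mean_def
    by (subst avg_swap) (rule avg_le_const, auto)
  moreover have "0 \<le> u a" for a
    unfolding u_def exp_mean_def by (intro avg_ge_const) auto
  ultimately have D_card: "real (card P) \<le> 2 * real (card D)"
    unfolding D_def by (intro card_ge_half_of_avg_le finP) auto
  have finD: "finite D" using finP by (simp add: D_def)
  have D_sub: "a i \<in> ?G" if "a \<in> D" "i < k" for a i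
    using that A by (auto simp: D_def P_def)

  define Q where "Q = ?I \<rightarrow>\<^sub>E ?G"
  \<comment> \<open>Diagonal translation of a sample. It permutes \<open>Q\<close>, so each
    \<open>y\<close> carries exactly \<open>card D\<close> elements of \<open>Q\<close> into
    \<open>D\<close>.\<close>
  define sh where "sh = (\<lambda>y b. \<lambda>i\<in>?I. b i \<oplus> y)"
  have finQ: "finite Q" and Q_card: "card Q = card ?G ^ k"
    by (simp_all add: Q_def finite_PiE card_PiE)
  have Q_ne: "Q \<noteq> {}" by (simp add: Q_def PiE_eq_empty_iff)
  have fib: "card {b \<in> Q. sh y b \<in> D} = card D" if y: "y \<in> ?G" for y
  proof (rule bij_betw_same_card[where f = "sh y"], rule bij_betwI[where g = "sh (\<ominus> y)"])
    show "sh y \<in> {b \<in> Q. sh y b \<in> D} \<rightarrow> D" by auto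
    have inv: "sh y (sh (\<ominus> y) a) = a" if "a \<in> D" for a
      using that y D_sub[OF that]
      by (auto simp: sh_def D_def P_def fun_eq_iff a_assoc l_neg PiE_iff extensional_def)
    then show "\<And>a. a \<in> D \<Longrightarrow> sh y (sh (\<ominus> y) a) = a" .
    show "sh (\<ominus> y) \<in> D \<rightarrow> {b \<in> Q. sh y b \<in> D}"
      using y D_sub by (auto simp: inv) (auto simp: sh_def Q_def)
    show "sh (\<ominus> y) (sh y b) = b" if "b \<in> {b \<in> Q. sh y b \<in> D}" for b
      using that y
      by (auto simp: sh_def Q_def fun_eq_iff a_assoc r_neg PiE_iff extensional_def)
  qed
  have "(\<Sum>b\<in>Q. card {y \<in> ?G. sh y b \<in> D}) = (\<Sum>y\<in>?G. card {b \<in> Q. sh y b \<in> D})"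
    using sum_multicount_gen[OF finQ finite_carrier, of "\<lambda>b y. sh y b \<in> D"
      "\<lambda>y. card {b \<in> Q. sh y b \<in> D}"] by simp
  also have "\<dots> = card ?G * card D" by (simp add: fib)
  finally have count: "(\<Sum>b\<in>Q. card {y \<in> ?G. sh y b \<in> D}) = card ?G * card D" .
  \<comment> \<open>Pigeonhole: averaged over \<open>b\<close>, the number of diagonal shifts that
    land in \<open>D\<close> equals the left-hand side.\<close>
  have "\<exists>b\<in>Q. real (card ?G * card D) / card Q \<le> card {y \<in> ?G. sh y b \<in> D}"
  proof (rule ccontr)
    assume "\<not> ?thesis"
    then have "(\<Sum>b\<in>Q. real (card {y \<in> ?G. sh y b \<in> D})) < (\<Sum>b\<in>Q. real (card ?G * card D) / card Q)"
      using finQ Q_ne by (intro sum_strict_mono) (auto simp: not_le)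
    also have "\<dots> = card ?G * card D" using finQ Q_ne by simp
    finally have "real (\<Sum>b\<in>Q. card {y \<in> ?G. sh y b \<in> D}) < card ?G * card D"
      by (simp add: of_nat_sum)
    then show False unfolding count by simp
  qed
  then obtain b where b: "b \<in> Q" "real (card ?G * card D) / card Q \<le> card {y \<in> ?G. sh y b \<in> D}"
    by blast
  define T0 where "T0 = {y \<in> ?G. sh y b \<in> D}"
  have finT0: "finite T0" by (simp add: T0_def)
  have card_T0: "(card A / card ?G) ^ k * card ?G \<le> 2 * real (card T0)"
  proof -
    have "(card A / card ?G) ^ k * card ?G = real (card P) * card ?G / card Q"
      by (simp add: P_def card_PiE Q_card power_divide)
    also have "\<dots> \<le> 2 * (real (card ?G * card D) / card Q)"
      using mult_right_mono[OF D_card, of "card ?G / card Q"] by (simp add: field_simps)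
    also have "\<dots> \<le> 2 * real (card T0)" using b(2) by (simp add: T0_def)
    finally show ?thesis .
  qed
  have "card T0 \<noteq> 0"
  proof
    assume "card T0 = 0"
    moreover have "0 < (card A / card ?G) ^ k * card ?G"
      using A finA card_carrier_pos by (simp add: card_gt_0_iff)
    ultimately show False using card_T0 by simp
  qed
  then obtain y0 where y0: "y0 \<in> T0" by (metis card.empty equals0I)
  have y0G: "y0 \<in> ?G" using y0 by (simp add: T0_def)
  have bG: "b i \<in> ?G" if "i < k" for i using b(1) that by (auto simp: Q_def)
  have T0_mean: "exp_mean \<mu> (\<lambda>x. h b x - f (x \<oplus> y)) \<le> 4 * exp (\<mu>\<^sup>2 / k)" if y: "y \<in> T0" for y
  proof -
    have yG: "y \<in> ?G" using y by (simp add: T0_def)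
    \<comment> \<open>Shifting sample and argument together leaves the empirical average unchanged.
      Hence goodness of \<open>sh y b\<close> says that the fixed function \<open>h b\<close> is
      close to the translate of \<open>f\<close> by \<open>y\<close>.\<close>
    have "exp_mean \<mu> (\<lambda>x. h b x - f (x \<oplus> y)) = exp_mean \<mu> (\<lambda>x. h (sh y b) (x \<oplus> y) - f (x \<oplus> y))"
    proof (rule exp_mean_cong)
      fix x assume x: "x \<in> ?G"
      have "x \<oplus> y \<ominus> (b i \<oplus> y) = x \<ominus> b i" if "i < k" for i
      proof -
        have "x \<oplus> y \<ominus> (b i \<oplus> y) = x \<ominus> b i \<oplus> (y \<ominus> y)"
          using x yG bG[OF that] by (simp add: a_minus_def minus_add a_ac)
        then show ?thesis using x yG bG[OF that] by (simp add: r_neg a_minus_def)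
      qed
      then have "h (sh y b) (x \<oplus> y) = h b x"
        unfolding h_def sh_def by (intro avg_cong) simp
      then show "h b x - f (x \<oplus> y) = h (sh y b) (x \<oplus> y) - f (x \<oplus> y)" by simp
    qed
    also have "\<dots> = u (sh y b)"
      unfolding u_def by (rule exp_mean_translate[OF yG])
    also have "\<dots> \<le> 4 * exp (\<mu>\<^sup>2 / k)"
      using y by (simp add: T0_def D_def)
    finally show ?thesis .
  qed
  \<comment> \<open>All translates of \<open>f\<close> by elements of \<open>T0\<close> are close to
    the same \<open>h b\<close>, so differences of such elements are almost periods. Fixing
    \<open>y0\<close> preserves the cardinality.\<close>
  define T where "T = (\<lambda>y. y \<ominus> y0) ` T0"
  have "inj_on (\<lambda>y. y \<ominus> y0) T0"
    using y0G by (auto simp: inj_on_def T0_def a_minus_def)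
  then have "card T = card T0" by (simp add: T_def card_image)
  moreover have "T \<subseteq> ?G" using y0G by (auto simp: T_def T0_def)
  moreover have "T \<noteq> {}" using y0 by (auto simp: T_def)
  moreover have "exp_mean (\<mu> / 2) (\<lambda>x. f (x \<oplus> t) - f x) \<le> 4 * exp (\<mu>\<^sup>2 / k)" if "t \<in> T" for t
  proof -
    from that obtain y where y: "y \<in> T0" "t = y \<ominus> y0" by (auto simp: T_def)
    have yG: "y \<in> ?G" using y by (simp add: T0_def)
    have "exp_mean (\<mu> / 2) (\<lambda>x. f (x \<oplus> t) - f x)
      = exp_mean (\<mu> / 2) (\<lambda>x. f (x \<oplus> y0 \<oplus> t) - f (x \<oplus> y0))"
      by (rule exp_mean_translate[OF y0G, symmetric])
    also have "\<dots> = exp_mean (\<mu> / 2) (\<lambda>x. (f (x \<oplus> y) - h b x) + (h b x - f (x \<oplus> y0)))"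
    proof (rule exp_mean_cong)
      fix x assume "x \<in> ?G"
      then have "x \<oplus> y0 \<oplus> t = x \<oplus> y \<oplus> (y0 \<ominus> y0)"
        using y0G yG unfolding y by (simp add: a_minus_def a_ac)
      then have "x \<oplus> y0 \<oplus> t = x \<oplus> y"
        using y0G yG \<open>x \<in> carrier G\<close> by (simp add: a_minus_def r_neg)
      then show "f (x \<oplus> y0 \<oplus> t) - f (x \<oplus> y0) = (f (x \<oplus> y) - h b x) + (h b x - f (x \<oplus> y0))"
        by simp
    qed
    also have "\<dots> \<le> avg ?G (\<lambda>x. (1/2) * exp (\<mu> * \<bar>h b x - f (x \<oplus> y)\<bar>) + (1/2) * exp (\<mu> * \<bar>h b x - f (x \<oplus> y0)\<bar>))"
      unfolding exp_mean_def
    proof (rule avg_mono)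
      fix x
      let ?p = "\<mu> * \<bar>h b x - f (x \<oplus> y)\<bar>" and ?q = "\<mu> * \<bar>h b x - f (x \<oplus> y0)\<bar>"
      have "\<bar>(f (x \<oplus> y) - h b x) + (h b x - f (x \<oplus> y0))\<bar> \<le> \<bar>h b x - f (x \<oplus> y)\<bar> + \<bar>h b x - f (x \<oplus> y0)\<bar>"
        by linarith
      \<comment> \<open>Halving the exponent pays for the triangle inequality: the two errors then
        separate by the inequality between arithmetic and geometric means.\<close>
      then have "exp (\<mu> / 2 * \<bar>(f (x \<oplus> y) - h b x) + (h b x - f (x \<oplus> y0))\<bar>) \<le> exp ((?p + ?q) / 2)"
        using mult_left_mono[of _ _ "\<mu> / 2"] lam by (fastforce simp: algebra_simps)
      also have "\<dots> = exp (?p / 2) * exp (?q / 2)"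
        by (simp add: exp_add[symmetric] add_divide_distrib)
      also have "\<dots> \<le> (1/2) * (exp (?p / 2))\<^sup>2 + (1/2) * (exp (?q / 2))\<^sup>2"
        using sum_squares_ge_zero[of "exp (?p / 2) - exp (?q / 2)" 0]
        by (simp add: power2_eq_square algebra_simps)
      also have "\<dots> = (1/2) * exp ?p + (1/2) * exp ?q"
        by (simp add: power2_eq_square exp_add[symmetric])
      finally show "exp (\<mu> / 2 * \<bar>(f (x \<oplus> y) - h b x) + (h b x - f (x \<oplus> y0))\<bar>) \<le> (1/2) * exp ?p + (1/2) * exp ?q" .
    qed
    also have "\<dots> \<le> 4 * exp (\<mu>\<^sup>2 / k)"
      unfolding avg_add avg_cmult using T0_mean[OF y(1)] T0_mean[OF y0]
      by (simp add: exp_mean_def)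
    finally show ?thesis .
  qed
  ultimately show ?thesis using card_T0 by (intro exI[of _ T]) simp
qed

end

section \<open>Characters and the large spectrum\<close>

text \<open>Take a proper subgroup \<open>H\<close> of largest order and \<open>x\<close> outside
  it. By maximality \<open>H\<close> and \<open>x\<close> generate the group, so the quotient by
  \<open>H\<close> is cyclic of order \<open>r\<close>, and a primitive \<open>r\<close>-th root of
  unity yields a character that is trivial on \<open>H\<close> but not at \<open>x\<close>.\<close>

lemma (in comm_group) exists_nontrivial_character:
  assumes fin: "finite (carrier G)" and nontriv: "carrier G \<noteq> {\<one>}"
  shows "\<exists>\<chi> :: 'a \<Rightarrow> complex. (\<forall>x\<in>carrier G. \<forall>y\<in>carrier G. \<chi> (x \<otimes> y) = \<chi> x * \<chi> y) \<and>
    (\<forall>x\<in>carrier G. cmod (\<chi> x) = 1) \<and> (\<exists>x\<in>carrier G. \<chi> x \<noteq> 1)"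
proof -
  define \<H> where "\<H> = {H. subgroup H G \<and> H \<noteq> carrier G}"
  have "\<H> \<subseteq> Pow (carrier G)" by (auto simp: \<H>_def dest: subgroup.subset)
  then have "finite \<H>" using fin finite_subset by blast
  moreover have "{\<one>} \<in> \<H>" using nontriv triv_subgroup by (auto simp: \<H>_def)
  ultimately have "Max (card ` \<H>) \<in> card ` \<H>" by (intro Max_in) auto
  then obtain H where H: "H \<in> \<H>" and "card H = Max (card ` \<H>)" by auto
  then have max: "card K \<le> card H" if "K \<in> \<H>" for K
    using that \<open>finite \<H>\<close> by simp
  have subH: "subgroup H G" and "H \<noteq> carrier G" using H by (auto simp: \<H>_def)
  then obtain x where x: "x \<in> carrier G" "x \<notin> H" using subgroup.subset by blast
  have HG: "h \<in> carrier G" if "h \<in> H" for h using subH that by (rule subgroup.mem_carrier)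
  have "\<exists>r>0. x [^] (r::nat) \<in> H"
    using subgroup.one_closed[OF subH] pow_order_eq_1[OF x(1)] fin order_gt_0_iff_finite by auto
  \<comment> \<open>The order of \<open>x\<close> modulo \<open>H\<close>.\<close>
  define r where "r = (LEAST r. 0 < r \<and> x [^] (r::nat) \<in> H)"
  have r: "0 < r" "x [^] r \<in> H"
    using LeastI_ex[OF \<open>\<exists>r>0. x [^] r \<in> H\<close>] by (auto simp: r_def[symmetric])
  have r_least: "\<not> (0 < j \<and> j < r \<and> x [^] j \<in> H)" for j :: nat
    unfolding r_def using not_less_Least by blast
  have r_dvd: "int r dvd j" if "x [^] j \<in> H" for j :: int
  proof -
    define k where "k = - (j div int r)"
    have "j mod int r = j + int r * k" by (simp add: k_def minus_mult_div_eq_mod)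
    then have "x [^] (j mod int r) = x [^] j \<otimes> (x [^] int r) [^] k"
      using x(1) by (simp only: int_pow_mult int_pow_pow)
    also have "\<dots> \<in> H"
    proof -
      have "x [^] int r \<in> H" using r(2) by (simp add: int_pow_int)
      then have "(x [^] int r) [^] k \<in> H" for k :: int
        by (rule subgroup_int_pow_closed[OF subH])
      then show ?thesis using that subH by (intro subgroup.m_closed) auto
    qed
    finally have mem: "x [^] (j mod int r) \<in> H" .
    have bounds: "0 \<le> j mod int r" "j mod int r < int r" using r(1) by simp_all
    obtain m where m: "j mod int r = int m" using zero_le_imp_eq_int[OF bounds(1)] by (rule exE)
    have "x [^] m \<in> H" using mem unfolding m int_pow_int .
    moreover have "m < r" using bounds(2) unfolding m by (simp only: of_nat_less_iff)
    ultimately have "m = 0" using r_least[of m] by (cases "m = 0") simp_all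
    then have "j mod int r = 0" unfolding m by (simp only: of_nat_0)
    then show ?thesis by (rule dvd_eq_mod_eq_0[THEN iffD2])
  qed
  define K where "K = {h \<otimes> x [^] j | h (j::int). h \<in> H}"
  have HK: "H \<subseteq> K"
  proof
    fix h assume "h \<in> H"
    then show "h \<in> K" using HG by (auto simp: K_def intro!: exI[of _ h] exI[of _ "0::int"])
  qed
  have xK: "x \<in> K" unfolding K_def
    using x(1) subgroup.one_closed[OF subH] by (auto intro!: exI[of _ "\<one>"] exI[of _ "1::int"])
  have subK: "subgroup K G"
  proof (rule subgroupI)
    show "K \<subseteq> carrier G" using HG x(1) by (auto simp: K_def)
    show "K \<noteq> {}" using xK by auto
    fix a assume "a \<in> K"
    then obtain h j where a: "h \<in> H" "a = h \<otimes> x [^] (j::int)" by (auto simp: K_def)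
    then have "inv a = inv h \<otimes> x [^] (- j)"
      using HG x(1) by (simp add: inv_mult int_pow_neg)
    then show "inv a \<in> K"
      using a subgroup.m_inv_closed[OF subH] by (auto simp: K_def)
    fix b assume "b \<in> K"
    then obtain h' j' where b: "h' \<in> H" "b = h' \<otimes> x [^] (j'::int)" by (auto simp: K_def)
    have "a \<otimes> b = (h \<otimes> h') \<otimes> x [^] (j + j')"
      using a b HG x(1) by (simp add: int_pow_mult m_ac)
    then show "a \<otimes> b \<in> K"
      using a b subgroup.m_closed[OF subH] by (auto simp: K_def)
  qed
  have "K = carrier G"
  proof (rule ccontr)
    assume "K \<noteq> carrier G"
    then have "card K \<le> card H" using max subK by (simp add: \<H>_def)
    moreover have "finite K" using fin subgroup.subset[OF subK] finite_subset by blast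
    ultimately have "H = K" using HK by (simp add: card_seteq)
    then show False using x xK by simp
  qed
  then have ex: "\<exists>j::int. \<exists>h\<in>H. y = h \<otimes> x [^] j" if "y \<in> carrier G" for y
    using that unfolding \<open>K = carrier G\<close>[symmetric] K_def by blast
  define e where "e = (\<lambda>j::int. cis (2 * pi * j / r))"
  \<comment> \<open>By \<open>r_dvd\<close> the exponent is determined modulo \<open>r\<close>, so
    the choice made by \<open>SOME\<close> does not affect the value.\<close>
  define \<chi> where "\<chi> = (\<lambda>y. e (SOME j. \<exists>h\<in>H. y = h \<otimes> x [^] j))"
  have e_add: "e (i + j) = e i * e j" for i j
    by (simp add: e_def cis_mult add_divide_distrib ring_distribs)
  have e_cong: "e i = e j" if "int r dvd i - j" for i j
  proof -
    from that obtain k where "i - j = int r * k" by (elim dvdE)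
    then have "i = int r * k + j" by simp
    then have "e i = e (int r * k) * e j" by (simp only: e_add)
    moreover have "e (int r * k) = 1"
      using r(1) cis_multiple_2pi[of "of_int k"] by (simp add: e_def mult.assoc)
    ultimately show ?thesis by simp
  qed
  have \<chi>_eq: "\<chi> (h \<otimes> x [^] j) = e j" if h: "h \<in> H" for h and j :: int
  proof -
    have "\<exists>i. \<exists>h'\<in>H. h \<otimes> x [^] j = h' \<otimes> x [^] (i::int)" using h by blast
    from someI_ex[OF this] obtain i h' where i: "i = (SOME i. \<exists>h'\<in>H. h \<otimes> x [^] j = h' \<otimes> x [^] (i::int))"
      and h': "h' \<in> H" "h \<otimes> x [^] j = h' \<otimes> x [^] i" by blast
    have "x [^] (i - j) = x [^] i \<otimes> inv (x [^] j)"
      using x(1) by (simp add: int_pow_diff)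
    also have "\<dots> = inv h' \<otimes> (h' \<otimes> x [^] i) \<otimes> inv (x [^] j)"
      using HG[OF h'(1)] x(1) by (simp add: m_assoc[symmetric])
    also have "\<dots> = inv h' \<otimes> h"
      unfolding h'(2)[symmetric] using HG[OF h'(1)] HG[OF h] x(1) by (simp add: m_assoc)
    also have "\<dots> \<in> H"
      using subH h h' by (simp add: subgroup.m_closed subgroup.m_inv_closed)
    finally have "e i = e j" by (intro e_cong r_dvd)
    then show ?thesis by (simp add: \<chi>_def i)
  qed
  have "\<chi> (y \<otimes> z) = \<chi> y * \<chi> z" if yz: "y \<in> carrier G" "z \<in> carrier G" for y z
  proof -
    obtain h i where y: "h \<in> H" "y = h \<otimes> x [^] (i::int)" using ex yz by blast
    obtain h' j where z: "h' \<in> H" "z = h' \<otimes> x [^] (j::int)" using ex yz by blast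
    have "y \<otimes> z = (h \<otimes> h') \<otimes> x [^] (i + j)"
      using y z HG x(1) by (simp add: int_pow_mult m_ac)
    moreover have "h \<otimes> h' \<in> H" using y z subgroup.m_closed[OF subH] by simp
    ultimately show ?thesis using y z by (simp add: \<chi>_eq e_add)
  qed
  moreover have "cmod (\<chi> y) = 1" for y by (simp add: \<chi>_def e_def)
  moreover have "\<chi> x \<noteq> 1"
  proof
    assume "\<chi> x = 1"
    moreover have "\<chi> x = e 1"
      using \<chi>_eq[OF subgroup.one_closed[OF subH], of 1] x(1) by simp
    ultimately have "cos (2 * pi / r) = 1"
      by (simp add: e_def complex_eq_iff)
    then obtain k :: int where "2 * pi / r = k * 2 * pi" by (auto simp: cos_one_2pi_int)
    then have "of_int (k * int r) = (1 :: real)" using r(1) by (simp add: field_simps)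
    then have "k * int r = 1" by linarith
    then have "r = 1" by (simp add: zmult_eq_1_iff)
    then show False using r(2) x by simp
  qed
  ultimately show ?thesis using x(1) by blast
qed

lemma (in field) exists_additive_character:
  assumes "finite (carrier R)"
  shows "\<exists>\<psi> :: 'a \<Rightarrow> complex. (\<forall>x\<in>carrier R. \<forall>y\<in>carrier R. \<psi> (x \<oplus> y) = \<psi> x * \<psi> y) \<and>
    (\<forall>x\<in>carrier R. cmod (\<psi> x) = 1) \<and> (\<exists>x\<in>carrier R. \<psi> x \<noteq> 1)"
proof -
  have "carrier R \<noteq> {\<zero>}" by (metis one_closed singletonD zero_not_one)
  then show ?thesis
    using comm_group.exists_nontrivial_character[OF a_comm_group] assms by simp
qed

section \<open>The space \<open>F^n\<close> with its dot product\<close>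

locale finite_field_space = field F for F (structure) +
  fixes n :: nat and \<psi> :: "'a \<Rightarrow> complex"
  assumes finite_field [simp]: "finite (carrier F)"
    and psi_add: "\<lbrakk>a \<in> carrier F; b \<in> carrier F\<rbrakk> \<Longrightarrow> \<psi> (a \<oplus> b) = \<psi> a * \<psi> b"
    and psi_norm [simp]: "a \<in> carrier F \<Longrightarrow> cmod (\<psi> a) = 1"
    and psi_nontrivial: "\<exists>a\<in>carrier F. \<psi> a \<noteq> 1"
begin

abbreviation "G \<equiv> coord_space F n"
abbreviation "N \<equiv> card (carrier (coord_space F n))"

lemma carrier_coord: "carrier G = {..<n} \<rightarrow>\<^sub>E carrier F"
  by (simp add: coord_space_def)

sublocale G: finite_abelian_group "coord_space F n"
proof -
  interpret V: vectorspace F "coord_space F n"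
    by (rule coord_space_vectorspace) (rule field_axioms)
  show "finite_abelian_group (coord_space F n)"
    by unfold_locales (simp add: carrier_coord finite_PiE)
qed

sublocale V: vectorspace F "coord_space F n"
  by (rule coord_space_vectorspace) (rule field_axioms)

lemma card_coord: "N = card (carrier F) ^ n"
  by (simp add: carrier_coord card_PiE)

definition dot :: "(nat \<Rightarrow> 'a) \<Rightarrow> (nat \<Rightarrow> 'a) \<Rightarrow> 'a" where
  "dot s x = (\<Oplus>i\<in>{..<n}. s i \<otimes> x i)"

lemma coord_mem: "x \<in> carrier G \<Longrightarrow> i < n \<Longrightarrow> x i \<in> carrier F"
  by (auto simp: carrier_coord)

lemma dot_closed [simp]: "s \<in> carrier G \<Longrightarrow> x \<in> carrier G \<Longrightarrow> dot s x \<in> carrier F"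
  unfolding dot_def by (intro finsum_closed) (auto simp: coord_mem)

lemma dot_add_right:
  assumes "s \<in> carrier G" "x \<in> carrier G" "y \<in> carrier G"
  shows "dot s (x \<oplus>\<^bsub>G\<^esub> y) = dot s x \<oplus> dot s y"
proof -
  have "dot s (x \<oplus>\<^bsub>G\<^esub> y) = (\<Oplus>i\<in>{..<n}. s i \<otimes> x i \<oplus> s i \<otimes> y i)"
    unfolding dot_def using assms
    by (intro finsum_cong') (auto simp: coord_mem coord_space_def r_distr)
  also have "\<dots> = dot s x \<oplus> dot s y"
    unfolding dot_def using assms by (intro finsum_addf) (auto simp: coord_mem)
  finally show ?thesis .
qed

lemma dot_add_left:
  assumes "s \<in> carrier G" "s' \<in> carrier G" "x \<in> carrier G"
  shows "dot (s \<oplus>\<^bsub>G\<^esub> s') x = dot s x \<oplus> dot s' x"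
proof -
  have "dot (s \<oplus>\<^bsub>G\<^esub> s') x = (\<Oplus>i\<in>{..<n}. s i \<otimes> x i \<oplus> s' i \<otimes> x i)"
    unfolding dot_def using assms
    by (intro finsum_cong') (auto simp: coord_mem coord_space_def l_distr)
  also have "\<dots> = dot s x \<oplus> dot s' x"
    unfolding dot_def using assms by (intro finsum_addf) (auto simp: coord_mem)
  finally show ?thesis .
qed

lemma dot_smult:
  assumes "s \<in> carrier G" "a \<in> carrier F" "x \<in> carrier G"
  shows "dot s (a \<odot>\<^bsub>G\<^esub> x) = a \<otimes> dot s x"
proof -
  have "dot s (a \<odot>\<^bsub>G\<^esub> x) = (\<Oplus>i\<in>{..<n}. a \<otimes> (s i \<otimes> x i))"
    unfolding dot_def using assms
    by (intro finsum_cong') (auto simp: coord_mem coord_space_def m_lcomm)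
  also have "\<dots> = a \<otimes> dot s x"
    unfolding dot_def using assms by (intro finsum_rdistr[symmetric]) (auto simp: coord_mem)
  finally show ?thesis .
qed

lemma dot_zero [simp]:
  assumes "s \<in> carrier G"
  shows "dot s \<zero>\<^bsub>G\<^esub> = \<zero>"
  using dot_add_right[OF assms G.zero_closed G.zero_closed] assms by simp

lemma dot_uminus:
  assumes "s \<in> carrier G" "x \<in> carrier G"
  shows "dot s (\<ominus>\<^bsub>G\<^esub> x) = \<ominus> dot s x"
proof -
  have "dot s (\<ominus>\<^bsub>G\<^esub> x) \<oplus> dot s x = \<zero>"
    using dot_add_right[of s "\<ominus>\<^bsub>G\<^esub> x" x] assms by (simp add: G.l_neg)
  then show ?thesis using assms by (simp add: minus_equality)
qed

lemma dot_minus: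
  assumes "s \<in> carrier G" "x \<in> carrier G" "y \<in> carrier G"
  shows "dot s (x \<ominus>\<^bsub>G\<^esub> y) = dot s x \<ominus> dot s y"
  using assms by (simp add: a_minus_def dot_add_right dot_uminus)

text \<open>Nondegeneracy of the pairing: \<open>s\<close> can be supported on a single coordinate
  where \<open>x\<close> does not vanish.\<close>

lemma dot_surj:
  assumes x: "x \<in> carrier G" "x \<noteq> \<zero>\<^bsub>G\<^esub>" and b: "b \<in> carrier F"
  shows "\<exists>s\<in>carrier G. dot s x = b"
proof -
  have "\<exists>i<n. x i \<noteq> \<zero>"
  proof (rule ccontr)
    assume "\<not> ?thesis"
    then have "x = \<zero>\<^bsub>G\<^esub>" using x(1)
      by (auto simp: coord_space_def fun_eq_iff PiE_iff extensional_def)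
    then show False using x(2) by simp
  qed
  then obtain i where i: "i < n" "x i \<noteq> \<zero>" by blast
  have xi: "x i \<in> Units F" "x i \<in> carrier F" using i x(1) by (simp_all add: field_Units coord_mem)
  define s where "s = (\<lambda>j\<in>{..<n}. if j = i then b \<otimes> inv (x i) else \<zero>)"
  have s: "s \<in> carrier G" using xi b by (auto simp: s_def carrier_coord)
  have "dot s x = (\<Oplus>j\<in>{..<n}. if i = j then b \<otimes> inv (x j) \<otimes> x j else \<zero>)"
    unfolding dot_def using x(1) xi b
    by (intro finsum_cong') (auto simp: s_def coord_mem)
  also have "\<dots> = b \<otimes> inv (x i) \<otimes> x i"
  proof -
    have "(\<Oplus>j\<in>{..<n}. if i = j then b \<otimes> inv (x j) \<otimes> x j else \<zero>)
      = (\<Oplus>j\<in>{..<n}. if i = j then (\<lambda>_. b \<otimes> inv (x i) \<otimes> x i) j else \<zero>)"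
      using xi b by (intro finsum_cong') auto
    also have "\<dots> = b \<otimes> inv (x i) \<otimes> x i"
      using i(1) xi b by (subst finsum_singleton) auto
    finally show ?thesis .
  qed
  also have "\<dots> = b" using xi b by (simp add: m_assoc)
  finally show ?thesis using s by blast
qed

section \<open>Characters of \<open>F^n\<close> and the Fourier transform\<close>

definition chi :: "(nat \<Rightarrow> 'a) \<Rightarrow> (nat \<Rightarrow> 'a) \<Rightarrow> complex" where
  "chi s x = \<psi> (dot s x)"

lemma psi_zero [simp]: "\<psi> \<zero> = 1"
proof -
  have "\<psi> \<zero> \<noteq> 0" using psi_norm[OF zero_closed] by (metis norm_zero zero_neq_one)
  then show ?thesis using psi_add[of \<zero> \<zero>] by simp
qed

lemma psi_minus: "a \<in> carrier F \<Longrightarrow> \<psi> (\<ominus> a) = cnj (\<psi> a)"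
proof -
  assume a: "a \<in> carrier F"
  have "\<psi> a * \<psi> (\<ominus> a) = 1" using psi_add[of a "\<ominus> a"] a by (simp add: r_neg)
  moreover have "\<psi> a * cnj (\<psi> a) = 1"
    using a by (simp add: complex_norm_square[symmetric])
  moreover have "\<psi> a \<noteq> 0" using psi_norm[OF a] by auto
  ultimately show ?thesis by (metis mult_left_cancel)
qed

lemma chi_add: "s \<in> carrier G \<Longrightarrow> x \<in> carrier G \<Longrightarrow> y \<in> carrier G \<Longrightarrow>
    chi s (x \<oplus>\<^bsub>G\<^esub> y) = chi s x * chi s y"
  by (simp add: chi_def dot_add_right psi_add)

lemma chi_minus: "s \<in> carrier G \<Longrightarrow> x \<in> carrier G \<Longrightarrow> y \<in> carrier G \<Longrightarrow>
    chi s (x \<ominus>\<^bsub>G\<^esub> y) = chi s x * cnj (chi s y)"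
  by (simp add: chi_def dot_minus) (simp add: a_minus_def psi_add psi_minus)

lemma chi_norm [simp]: "s \<in> carrier G \<Longrightarrow> x \<in> carrier G \<Longrightarrow> cmod (chi s x) = 1"
  by (simp add: chi_def)

text \<open>Translation by some \<open>b\<close> with \<open>\<psi> b \<noteq> 1\<close> permutes
  the summands and multiplies the sum by \<open>\<psi> b\<close>.\<close>

lemma sum_psi: "(\<Sum>a\<in>carrier F. \<psi> a) = 0"
proof -
  obtain b where b: "b \<in> carrier F" "\<psi> b \<noteq> 1" using psi_nontrivial by blast
  interpret A: finite_abelian_group F by unfold_locales simp
  have "(\<Sum>a\<in>carrier F. \<psi> a) = (\<Sum>a\<in>carrier F. \<psi> (a \<oplus> b))"
    by (rule A.sum_translate[OF b(1), symmetric])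
  also have "\<dots> = (\<Sum>a\<in>carrier F. \<psi> a) * \<psi> b"
    using b by (simp add: psi_add sum_distrib_right)
  finally show ?thesis using b(2) by simp
qed

text \<open>Orthogonality: for nonzero \<open>x\<close> the same translation argument works in the
  frequency variable, with a shift supplied by \<open>dot_surj\<close>.\<close>

lemma sum_chi:
  assumes x: "x \<in> carrier G"
  shows "(\<Sum>s\<in>carrier G. chi s x) = (if x = \<zero>\<^bsub>G\<^esub> then N else 0)"
proof (cases "x = \<zero>\<^bsub>G\<^esub>")
  case True
  then show ?thesis by (simp add: chi_def)
next
  case False
  obtain b where b: "b \<in> carrier F" "\<psi> b \<noteq> 1" using psi_nontrivial by blast
  obtain t where t: "t \<in> carrier G" "dot t x = b" using dot_surj[OF x False b(1)] by blast
  have "(\<Sum>s\<in>carrier G. chi s x) = (\<Sum>s\<in>carrier G. chi (s \<oplus>\<^bsub>G\<^esub> t) x)"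
    by (rule G.sum_translate[OF t(1), symmetric])
  also have "\<dots> = (\<Sum>s\<in>carrier G. chi s x) * \<psi> b"
    using b t x by (simp add: chi_def dot_add_left psi_add sum_distrib_right)
  finally show ?thesis using b(2) False by simp
qed

text \<open>The Fourier transform without normalisation and with \<open>chi\<close> in place of its
  conjugate; hence the factor \<open>N\<close> in \<open>parseval\<close> and the conjugates in
  \<open>hat_translate\<close> and \<open>hat_smooth\<close>.\<close>

definition hat :: "((nat \<Rightarrow> 'a) \<Rightarrow> real) \<Rightarrow> (nat \<Rightarrow> 'a) \<Rightarrow> complex" where
  "hat g s = (\<Sum>x\<in>carrier G. of_real (g x) * chi s x)"

text \<open>Expand the square into a double sum over \<open>x\<close> and \<open>y\<close>; summing
  over \<open>s\<close> first leaves only the diagonal.\<close>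

lemma parseval:
  fixes g :: "(nat \<Rightarrow> 'a) \<Rightarrow> real"
  shows "(\<Sum>s\<in>carrier G. (cmod (hat g s))\<^sup>2) = N * (\<Sum>x\<in>carrier G. (g x)\<^sup>2)"
proof -
  let ?C = "carrier G"
  have "complex_of_real (\<Sum>s\<in>?C. (cmod (hat g s))\<^sup>2) = (\<Sum>s\<in>?C. hat g s * cnj (hat g s))"
    by (simp add: complex_norm_square[symmetric])
  also have "\<dots> = (\<Sum>s\<in>?C. \<Sum>x\<in>?C. \<Sum>y\<in>?C. of_real (g x * g y) * chi s (x \<ominus>\<^bsub>G\<^esub> y))"
    unfolding hat_def cnj_sum sum_product
    by (intro sum.cong refl) (simp add: chi_minus mult_ac)
  also have "\<dots> = (\<Sum>x\<in>?C. \<Sum>y\<in>?C. \<Sum>s\<in>?C. of_real (g x * g y) * chi s (x \<ominus>\<^bsub>G\<^esub> y))"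
  proof (rule trans[OF sum.swap sum.cong[OF refl]])
    fix x show "(\<Sum>s\<in>?C. \<Sum>y\<in>?C. of_real (g x * g y) * chi s (x \<ominus>\<^bsub>G\<^esub> y))
      = (\<Sum>y\<in>?C. \<Sum>s\<in>?C. of_real (g x * g y) * chi s (x \<ominus>\<^bsub>G\<^esub> y))"
      by (rule sum.swap)
  qed
  also have "\<dots> = (\<Sum>x\<in>?C. \<Sum>y\<in>?C. complex_of_real (g x * g y) * of_nat (if x = y then N else 0))"
  proof (intro sum.cong refl)
    fix x y assume xy: "x \<in> ?C" "y \<in> ?C"
    then have "x \<ominus>\<^bsub>G\<^esub> y = \<zero>\<^bsub>G\<^esub> \<longleftrightarrow> x = y"
      by (simp add: G.minus_other_side a_minus_def G.add.inv_solve_right')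
    then show "(\<Sum>s\<in>?C. of_real (g x * g y) * chi s (x \<ominus>\<^bsub>G\<^esub> y))
      = of_real (g x * g y) * of_nat (if x = y then N else 0)"
      using xy by (simp add: sum_distrib_left[symmetric] sum_chi)
  qed
  also have "\<dots> = (\<Sum>x\<in>?C. of_real (g x * g x) * of_nat N)"
    by (intro sum.cong refl) (simp add: if_distrib[of of_nat] if_distrib[of "(*) _"] cong: if_cong)
  also have "\<dots> = complex_of_real (N * (\<Sum>x\<in>?C. (g x)\<^sup>2))"
    by (simp add: power2_eq_square sum_distrib_left mult.commute)
  finally show ?thesis using of_real_eq_iff by blast
qed

lemma hat_translate:
  assumes v: "v \<in> carrier G" and s: "s \<in> carrier G"
  shows "hat (\<lambda>x. g (x \<oplus>\<^bsub>G\<^esub> v)) s = hat g s * cnj (chi s v)"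
proof -
  have "hat (\<lambda>x. g (x \<oplus>\<^bsub>G\<^esub> v)) s
    = (\<Sum>x\<in>carrier G. of_real (g (x \<oplus>\<^bsub>G\<^esub> v)) * (chi s (x \<oplus>\<^bsub>G\<^esub> v) * cnj (chi s v)))"
    unfolding hat_def
  proof (intro sum.cong refl)
    fix x assume x: "x \<in> carrier G"
    have "chi s (x \<oplus>\<^bsub>G\<^esub> v) * cnj (chi s v) = chi s x * (chi s v * cnj (chi s v))"
      using x v s by (simp add: chi_add)
    also have "\<dots> = chi s x"
      using v s by (simp add: complex_norm_square[symmetric])
    finally show "of_real (g (x \<oplus>\<^bsub>G\<^esub> v)) * chi s x
      = of_real (g (x \<oplus>\<^bsub>G\<^esub> v)) * (chi s (x \<oplus>\<^bsub>G\<^esub> v) * cnj (chi s v))" by simp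
  qed
  also have "\<dots> = (\<Sum>x\<in>carrier G. of_real (g x) * (chi s x * cnj (chi s v)))"
    by (rule G.sum_translate[OF v])
  also have "\<dots> = hat g s * cnj (chi s v)"
    by (simp add: hat_def sum_distrib_right mult.assoc)
  finally show ?thesis .
qed

text \<open>Smoothing is a Fourier multiplier, because it averages translates.\<close>

lemma hat_smooth:
  assumes T: "T \<subseteq> carrier G" and s: "s \<in> carrier G"
  shows "hat (G.smooth T g) s = hat g s * cnj (avg T (chi s))"
proof -
  have "hat (G.smooth T g) s = (\<Sum>x\<in>carrier G. \<Sum>t\<in>T. of_real (g (x \<oplus>\<^bsub>G\<^esub> t)) * chi s x) / card T"
    by (simp add: hat_def G.smooth_def avg_def sum_distrib_right sum_divide_distrib)
  also have "\<dots> = (\<Sum>t\<in>T. hat (\<lambda>x. g (x \<oplus>\<^bsub>G\<^esub> t)) s) / card T"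
    unfolding hat_def by (subst sum.swap) simp
  also have "\<dots> = (\<Sum>t\<in>T. hat g s * cnj (chi s t)) / card T"
    using T s by (intro arg_cong2[where f = "(/)"] sum.cong) (auto simp: hat_translate)
  also have "\<dots> = hat g s * cnj (avg T (chi s))"
    by (simp add: avg_def sum_distrib_left)
  finally show ?thesis .
qed

lemma norm_hat_smooth_pow:
  assumes "T \<subseteq> carrier G" "s \<in> carrier G"
  shows "cmod (hat ((G.smooth T ^^ l) g) s) = cmod (hat g s) * cmod (avg T (chi s)) ^ l"
  by (induction l) (simp_all add: hat_smooth assms norm_mult)

text \<open>The large spectrum at level 1/2: outside it every smoothing at least halves the Fourier
  coefficient.\<close>

definition spec :: "(nat \<Rightarrow> 'a) set \<Rightarrow> (nat \<Rightarrow> 'a) set" where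
  "spec T = {s \<in> carrier G. 1/2 < cmod (avg T (chi s))}"

text \<open>The condition is on \<open>dot\<close> rather than on \<open>chi\<close>, which makes
  the annihilator closed under scalars and not just under addition.\<close>

definition perp :: "(nat \<Rightarrow> 'a) set \<Rightarrow> (nat \<Rightarrow> 'a) set" where
  "perp S = {v \<in> carrier G. \<forall>s\<in>S. dot s v = \<zero>}"

text \<open>The transform of the difference vanishes on \<open>spec T\<close>, where
  \<open>chi s v = 1\<close>. Elsewhere \<open>l\<close> smoothings gain \<open>(1/2)^l\<close> and
  the difference costs a factor 2; squaring gives \<open>4 * (1/4)^l\<close>. Parseval translates in
  both directions.\<close>

lemma smooth_pow_invariant_L2:
  assumes T: "T \<subseteq> carrier G" and v: "v \<in> perp (spec T)" and g: "\<And>x. \<bar>g x\<bar> \<le> 1"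
  shows "(\<Sum>x\<in>carrier G. ((G.smooth T ^^ l) g (x \<oplus>\<^bsub>G\<^esub> v) - (G.smooth T ^^ l) g x)\<^sup>2) \<le> 4 * (1/4) ^ l * N"
proof -
  define M where "M = (G.smooth T ^^ l) g"
  define D where "D = (\<lambda>x. M (x \<oplus>\<^bsub>G\<^esub> v) - M x)"
  have vG: "v \<in> carrier G" using v by (simp add: perp_def)
  have hatD: "hat D s = hat M s * (cnj (chi s v) - 1)" if "s \<in> carrier G" for s
  proof -
    have "hat D s = hat (\<lambda>x. M (x \<oplus>\<^bsub>G\<^esub> v)) s - hat M s"
      by (simp add: hat_def D_def sum_subtractf left_diff_distrib)
    then show ?thesis using that vG by (simp add: hat_translate right_diff_distrib)
  qed
  have bound: "(cmod (hat D s))\<^sup>2 \<le> 4 * (1/4) ^ l * (cmod (hat g s))\<^sup>2" if s: "s \<in> carrier G" for s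
  proof (cases "s \<in> spec T")
    case True
    then have "chi s v = 1" using v by (simp add: perp_def chi_def)
    then show ?thesis using s by (simp add: hatD)
  next
    case False
    then have "cmod (avg T (chi s)) \<le> 1/2" using s by (simp add: spec_def)
    then have "cmod (avg T (chi s)) ^ l \<le> (1/2) ^ l" by (intro power_mono) auto
    then have "cmod (hat M s) \<le> cmod (hat g s) * (1/2) ^ l"
      unfolding M_def norm_hat_smooth_pow[OF T s] by (intro mult_left_mono) auto
    moreover have "cmod (cnj (chi s v) - 1) \<le> 2"
      using norm_triangle_ineq4[of "cnj (chi s v)" 1] s vG by simp
    ultimately have "cmod (hat D s) \<le> (cmod (hat g s) * (1/2) ^ l) * 2"
      unfolding hatD[OF s] norm_mult by (intro mult_mono) auto
    then have "(cmod (hat D s))\<^sup>2 \<le> ((cmod (hat g s) * (1/2) ^ l) * 2)\<^sup>2"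
      by (intro power_mono) auto
    also have "\<dots> = 4 * (1/4) ^ l * (cmod (hat g s))\<^sup>2"
    proof -
      have "((1/2::real) ^ l)\<^sup>2 = (1/4) ^ l"
        by (simp add: power2_eq_square power_mult_distrib[symmetric])
      then show ?thesis by (simp add: power_mult_distrib)
    qed
    finally show ?thesis .
  qed
  have "N * (\<Sum>x\<in>carrier G. (D x)\<^sup>2) = (\<Sum>s\<in>carrier G. (cmod (hat D s))\<^sup>2)"
    by (rule parseval[symmetric])
  also have "\<dots> \<le> (\<Sum>s\<in>carrier G. 4 * (1/4) ^ l * (cmod (hat g s))\<^sup>2)"
    by (intro sum_mono bound)
  also have "\<dots> = 4 * (1/4) ^ l * (N * (\<Sum>x\<in>carrier G. (g x)\<^sup>2))"
    by (simp add: sum_distrib_left[symmetric] parseval)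
  also have "\<dots> \<le> 4 * (1/4) ^ l * (N * (\<Sum>x\<in>carrier G. 1 :: real))"
    by (intro mult_left_mono sum_mono) (auto simp: g abs_square_le_1)
  finally have "N * (\<Sum>x\<in>carrier G. (D x)\<^sup>2) \<le> N * (4 * (1/4) ^ l * N)" by (simp add: mult_ac)
  then have "(\<Sum>x\<in>carrier G. (D x)\<^sup>2) \<le> 4 * (1/4) ^ l * N"
    using G.card_carrier_pos by simp
  then show ?thesis by (simp add: D_def M_def)
qed

text \<open>Translations commute with convolution by \<open>A\<close>, hence so does
  smoothing.\<close>

lemma smooth_pow_convolution:
  assumes A: "A \<subseteq> carrier G" and T: "T \<subseteq> carrier G"
  shows "x \<in> carrier G \<Longrightarrow> (G.smooth T ^^ l) (\<lambda>x. avg A (\<lambda>a. g (x \<ominus>\<^bsub>G\<^esub> a))) x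
    = avg A (\<lambda>a. (G.smooth T ^^ l) g (x \<ominus>\<^bsub>G\<^esub> a))"
proof (induction l arbitrary: x)
  case (Suc l)
  have "(G.smooth T ^^ Suc l) (\<lambda>x. avg A (\<lambda>a. g (x \<ominus>\<^bsub>G\<^esub> a))) x
    = avg T (\<lambda>t. avg A (\<lambda>a. (G.smooth T ^^ l) g (x \<oplus>\<^bsub>G\<^esub> t \<ominus>\<^bsub>G\<^esub> a)))"
  proof -
    have "(G.smooth T ^^ l) (\<lambda>x. avg A (\<lambda>a. g (x \<ominus>\<^bsub>G\<^esub> a))) (x \<oplus>\<^bsub>G\<^esub> t)
      = avg A (\<lambda>a. (G.smooth T ^^ l) g (x \<oplus>\<^bsub>G\<^esub> t \<ominus>\<^bsub>G\<^esub> a))" if "t \<in> T" for t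
      using that T Suc.prems by (intro Suc.IH) auto
    then show ?thesis by (simp add: G.smooth_def[of T _ x] cong: avg_cong)
  qed
  also have "\<dots> = avg A (\<lambda>a. avg T (\<lambda>t. (G.smooth T ^^ l) g (x \<oplus>\<^bsub>G\<^esub> t \<ominus>\<^bsub>G\<^esub> a)))"
    by (rule avg_swap)
  also have "\<dots> = avg A (\<lambda>a. avg T (\<lambda>t. (G.smooth T ^^ l) g (x \<ominus>\<^bsub>G\<^esub> a \<oplus>\<^bsub>G\<^esub> t)))"
  proof (intro avg_cong)
    fix a t assume "a \<in> A" "t \<in> T"
    then have "x \<oplus>\<^bsub>G\<^esub> t \<ominus>\<^bsub>G\<^esub> a = x \<ominus>\<^bsub>G\<^esub> a \<oplus>\<^bsub>G\<^esub> t"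
      using A T Suc.prems by (auto simp: a_minus_def G.a_ac subset_iff)
    then show "(G.smooth T ^^ l) g (x \<oplus>\<^bsub>G\<^esub> t \<ominus>\<^bsub>G\<^esub> a) = (G.smooth T ^^ l) g (x \<ominus>\<^bsub>G\<^esub> a \<oplus>\<^bsub>G\<^esub> t)"
      by simp
  qed
  finally show ?case by (simp add: G.smooth_def[of T "(G.smooth T ^^ l) g"])
qed simp

text \<open>The convolution with \<open>A\<close> upgrades the mean-square estimate to a pointwise
  one: by Cauchy-Schwarz over \<open>x - A\<close> the loss is \<open>N / card A\<close>. The
  hypothesis on \<open>l\<close> makes \<open>4 * (1/4)^l * N / card A\<close> at most
  \<open>(1/4)^2\<close>.\<close>

lemma smooth_pow_convolution_invariant:
  assumes A: "A \<subseteq> carrier G" "A \<noteq> {}" and T: "T \<subseteq> carrier G" and v: "v \<in> perp (spec T)"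
    and g: "\<And>x. \<bar>g x\<bar> \<le> 1" and x: "x \<in> carrier G" and l: "64 * real N \<le> 4 ^ l * card A"
  defines "f \<equiv> \<lambda>x. avg A (\<lambda>a. g (x \<ominus>\<^bsub>G\<^esub> a))"
  shows "\<bar>(G.smooth T ^^ l) f (x \<oplus>\<^bsub>G\<^esub> v) - (G.smooth T ^^ l) f x\<bar> \<le> 1/4"
proof -
  define M where "M = (G.smooth T ^^ l) g"
  define D where "D = (\<lambda>x. M (x \<oplus>\<^bsub>G\<^esub> v) - M x)"
  have finA: "finite A" using A(1) G.finite_carrier by (rule finite_subset)
  have vG: "v \<in> carrier G" using v by (simp add: perp_def)
  have "(G.smooth T ^^ l) f (x \<oplus>\<^bsub>G\<^esub> v) - (G.smooth T ^^ l) f x = avg A (\<lambda>a. D (x \<ominus>\<^bsub>G\<^esub> a))"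
  proof -
    have "x \<oplus>\<^bsub>G\<^esub> v \<ominus>\<^bsub>G\<^esub> a = x \<ominus>\<^bsub>G\<^esub> a \<oplus>\<^bsub>G\<^esub> v" if "a \<in> A" for a
      using that A x vG by (auto simp: a_minus_def G.a_ac subset_iff)
    then show ?thesis
      unfolding f_def smooth_pow_convolution[OF A(1) T x]
        smooth_pow_convolution[OF A(1) T G.a_closed[OF x vG]] D_def M_def avg_diff[symmetric]
      by (intro avg_cong) simp
  qed
  moreover have "(avg A (\<lambda>a. D (x \<ominus>\<^bsub>G\<^esub> a)))\<^sup>2 \<le> (1/4)\<^sup>2"
  proof -
    have inj: "inj_on (\<lambda>a. x \<ominus>\<^bsub>G\<^esub> a) A"
      using A x by (auto simp: inj_on_def a_minus_def subset_iff) (metis G.minus_minus)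
    have "(avg A (\<lambda>a. D (x \<ominus>\<^bsub>G\<^esub> a)))\<^sup>2 \<le> avg A (\<lambda>a. (D (x \<ominus>\<^bsub>G\<^esub> a))\<^sup>2)"
      by (rule avg_square_le) fact+
    also have "\<dots> = (\<Sum>y\<in>(\<lambda>a. x \<ominus>\<^bsub>G\<^esub> a) ` A. (D y)\<^sup>2) / card A"
      using inj by (simp add: avg_def sum.reindex)
    also have "\<dots> \<le> (\<Sum>y\<in>carrier G. (D y)\<^sup>2) / card A"
      using A x by (intro divide_right_mono sum_mono2) auto
    also have "\<dots> \<le> 4 * (1/4) ^ l * N / card A"
      using smooth_pow_invariant_L2[OF T v g, where l = l]
      by (intro divide_right_mono) (auto simp: D_def M_def)
    also have "\<dots> \<le> (1/4)\<^sup>2"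
      using l A finA by (simp add: power_one_over field_simps card_gt_0_iff)
    finally show ?thesis .
  qed
  then have "\<bar>avg A (\<lambda>a. D (x \<ominus>\<^bsub>G\<^esub> a))\<bar> \<le> \<bar>1/4\<bar>" by (simp only: abs_le_square_iff)
  ultimately show ?thesis by simp
qed

text \<open>Chang's bound for the large spectrum, for linearly independent characters: these are
  independent random variables. The flag \<open>V\<close> grows one frequency at a time, and \<open>\<Phi>\<close> is the sum
  of the real parts of the rotated characters chosen so far.\<close>

definition spec_flag :: "(nat \<Rightarrow> 'a) set \<Rightarrow> nat \<Rightarrow> (nat \<Rightarrow> 'a) set \<Rightarrow> bool" where
  "spec_flag T m V \<longleftrightarrow> (\<exists>S \<Phi>. S \<subseteq> spec T \<and> V = perp S \<and> N \<le> card V * card (carrier F) ^ m \<and>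
     (\<forall>x\<in>carrier G. \<forall>v\<in>V. \<Phi> (x \<oplus>\<^bsub>G\<^esub> v) = \<Phi> x) \<and>
     m / 8 \<le> avg T \<Phi> \<and> avg (carrier G) (\<lambda>x. exp (\<Phi> x)) \<le> exp (m / 16))"

lemma spec_flag_0: "spec_flag T 0 (carrier G)"
  unfolding spec_flag_def
  by (intro exI[of _ "{}"] exI[of _ "\<lambda>_. 0"]) (auto simp: perp_def avg_const avg_def)

text \<open>Jensen on \<open>T\<close> bounds the mean of \<open>exp \<Phi>\<close> over
  \<open>T\<close> below by \<open>exp (m/8)\<close>. Passing from \<open>T\<close> to the whole
  space costs at most \<open>N / card T\<close>, and there the mean is at most
  \<open>exp (m/16)\<close>.\<close>

lemma spec_flag_bound:
  assumes T: "T \<subseteq> carrier G" "T \<noteq> {}" and flag: "spec_flag T m V"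
  shows "m \<le> 16 * ln (N / card T)"
proof -
  obtain \<Phi> where \<Phi>: "m / 8 \<le> avg T \<Phi>" "avg (carrier G) (\<lambda>x. exp (\<Phi> x)) \<le> exp (m / 16)"
    using flag by (auto simp: spec_flag_def)
  have finT: "finite T" using T(1) G.finite_carrier by (rule finite_subset)
  then have T0: "0 < card T" using T by (simp add: card_gt_0_iff)
  have "exp (m / 8) \<le> exp (avg T \<Phi>)" using \<Phi> by simp
  also have "\<dots> \<le> avg T (\<lambda>x. exp (\<Phi> x))" using finT T by (intro exp_avg_le)
  also have "\<dots> \<le> (\<Sum>x\<in>carrier G. exp (\<Phi> x)) / card T"
    unfolding avg_def using T by (intro divide_right_mono sum_mono2) auto
  also have "\<dots> = avg (carrier G) (\<lambda>x. exp (\<Phi> x)) * (N / card T)"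
    using G.card_carrier_pos by (simp add: avg_def)
  also have "\<dots> \<le> exp (m / 16) * (N / card T)"
    using \<Phi> by (intro mult_right_mono) auto
  finally have "exp (m / 16) * exp (m / 16) \<le> exp (m / 16) * (N / card T)"
    by (simp add: exp_add[symmetric])
  then have "exp (m / 16) \<le> N / card T" by (rule mult_left_le_imp_le) simp
  then have "m / 16 \<le> ln (N / card T)"
    using T0 G.card_carrier_pos by (subst ln_ge_iff) auto
  then show ?thesis by simp
qed

section \<open>Annihilators and the growth of the flag\<close>

lemma perp_insert: "perp (insert s S) = {v \<in> perp S. dot s v = \<zero>}"
  by (auto simp: perp_def)

lemma perp_minus:
  assumes "S \<subseteq> carrier G" "v \<in> perp S" "w \<in> perp S"
  shows "v \<ominus>\<^bsub>G\<^esub> w \<in> perp S"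
proof -
  have "v \<in> carrier G" "w \<in> carrier G" using assms by (auto simp: perp_def)
  moreover have "dot s (v \<ominus>\<^bsub>G\<^esub> w) = \<zero>" if "s \<in> S" for s
    using that assms by (auto simp: perp_def dot_minus subset_iff)
  ultimately show ?thesis by (auto simp: perp_def)
qed

lemma perp_smult:
  assumes "S \<subseteq> carrier G" "v \<in> perp S" "a \<in> carrier F"
  shows "a \<odot>\<^bsub>G\<^esub> v \<in> perp S"
  using assms by (auto simp: perp_def dot_smult subset_iff)

lemma perp_subspace:
  assumes "S \<subseteq> carrier G"
  shows "VectorSpace.subspace F (perp S) G"
proof -
  have "perp S \<subseteq> carrier G" by (auto simp: perp_def)
  moreover have "\<zero>\<^bsub>G\<^esub> \<in> perp S" using assms by (auto simp: perp_def)
  moreover have "v \<oplus>\<^bsub>G\<^esub> w \<in> perp S" if "v \<in> perp S" "w \<in> perp S" for v w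
    using that assms by (auto simp: perp_def dot_add_right subset_iff)
  ultimately show ?thesis
    using perp_smult[OF assms] V.vectorspace_axioms V.module_axioms
    by (auto simp: VectorSpace.subspace_def submodule_def)
qed

text \<open>The values of \<open>dot s\<close> split \<open>perp S\<close> into at most
  \<open>card (carrier F)\<close> fibres; subtracting a point of a fibre maps it injectively into
  the smaller annihilator.\<close>

lemma card_perp_insert:
  assumes S: "S \<subseteq> carrier G" and s: "s \<in> carrier G"
  shows "card (perp S) \<le> card (perp (insert s S)) * card (carrier F)"
proof -
  have finp: "finite (perp S')" for S'
    by (rule finite_subset[OF _ G.finite_carrier]) (auto simp: perp_def)
  have fibre: "card {v \<in> perp S. dot s v = a} \<le> card (perp (insert s S))" for a
  proof (cases "{v \<in> perp S. dot s v = a} = {}")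
    case False
    then obtain w where w: "w \<in> perp S" "dot s w = a" by blast
    then have wG: "w \<in> carrier G" "a \<in> carrier F" using s by (auto simp: perp_def)
    show ?thesis
    proof (rule card_inj_on_le[where f = "\<lambda>v. v \<ominus>\<^bsub>G\<^esub> w"])
      show "inj_on (\<lambda>v. v \<ominus>\<^bsub>G\<^esub> w) {v \<in> perp S. dot s v = a}"
        using wG by (auto simp: inj_on_def perp_def a_minus_def)
      show "(\<lambda>v. v \<ominus>\<^bsub>G\<^esub> w) ` {v \<in> perp S. dot s v = a} \<subseteq> perp (insert s S)"
      proof clarsimp
        fix v assume v: "v \<in> perp S" "a = dot s v"
        then have "v \<in> carrier G" by (simp add: perp_def)
        then show "v \<ominus>\<^bsub>G\<^esub> w \<in> perp (insert s S)"
          using perp_minus[OF S v(1) w(1)] v w wG s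
          by (simp add: perp_insert dot_minus)
      qed
    qed (rule finp)
  next
    case True
    show ?thesis unfolding True by simp
  qed
  have "perp S = (\<Union>a\<in>carrier F. {v \<in> perp S. dot s v = a})"
    using s by (auto simp: perp_def)
  then have "card (perp S) \<le> (\<Sum>a\<in>carrier F. card {v \<in> perp S. dot s v = a})"
    using card_UN_le[OF finite_field, of "\<lambda>a. {v \<in> perp S. dot s v = a}"] by simp
  also have "\<dots> \<le> (\<Sum>a\<in>carrier F. card (perp (insert s S)))"
    by (intro sum_mono fibre)
  finally show ?thesis by (simp add: mult.commute)
qed

lemma avg_psi_mult:
  assumes b: "b \<in> carrier F" "b \<noteq> \<zero>"
  shows "avg (carrier F) (\<lambda>a. \<psi> (a \<otimes> b)) = 0"
proof -
  have bu: "b \<in> Units F" using b by (simp add: field_Units)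
  have "bij_betw (\<lambda>a. a \<otimes> b) (carrier F) (carrier F)"
    by (rule bij_betwI[where g = "\<lambda>a. a \<otimes> inv b"]) (use b bu in \<open>auto simp: m_assoc\<close>)
  then have "(\<Sum>a\<in>carrier F. \<psi> (a \<otimes> b)) = (\<Sum>a\<in>carrier F. \<psi> a)"
    by (rule sum.reindex_bij_betw)
  then show ?thesis by (simp add: avg_def sum_psi)
qed

lemma avg_Re: "avg A (\<lambda>x. Re (f x)) = Re (avg A f)"
  by (simp add: avg_def Re_divide_of_nat)

text \<open>Some \<open>s\<close> in \<open>spec T\<close> fails to annihilate some \<open>v\<close>
  in \<open>V\<close>. On lines in direction \<open>v\<close> the function \<open>\<Phi>\<close> is
  constant while \<open>chi s\<close> has mean zero, so the new summand behaves like an independent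
  variable.\<close>

lemma spec_flag_Suc:
  assumes flag: "spec_flag T m V" and ne: "V \<noteq> perp (spec T)"
  shows "\<exists>V'. spec_flag T (Suc m) V'"
proof -
  obtain S \<Phi> where S: "S \<subseteq> spec T" and V: "V = perp S"
    and cardV: "N \<le> card V * card (carrier F) ^ m"
    and inv: "\<And>x v. x \<in> carrier G \<Longrightarrow> v \<in> V \<Longrightarrow> \<Phi> (x \<oplus>\<^bsub>G\<^esub> v) = \<Phi> x"
    and avgT: "m / 8 \<le> avg T \<Phi>" and avgG: "avg (carrier G) (\<lambda>x. exp (\<Phi> x)) \<le> exp (m / 16)"
    using flag unfolding spec_flag_def by blast
  have SG: "S \<subseteq> carrier G" using S by (auto simp: spec_def)
  have "perp (spec T) \<subseteq> V" using S by (auto simp: V perp_def)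
  then obtain v where "v \<in> V" "v \<notin> perp (spec T)" using ne by blast
  then obtain s where v: "v \<in> V" and s: "s \<in> spec T" and b: "dot s v \<noteq> \<zero>"
    by (auto simp: V perp_def)
  have vG: "v \<in> carrier G" and sG: "s \<in> carrier G" using v s by (auto simp: V perp_def spec_def)
  define z where "z = avg T (chi s)"
  have z: "1/2 < cmod z" using s by (simp add: spec_def z_def)
  have "z \<noteq> 0" using z by (intro notI) simp
  \<comment> \<open>The rotation that makes the mean of \<open>c * chi s\<close> over
    \<open>T\<close> equal to the positive real \<open>cmod z\<close>.\<close>
  define c where "c = cnj z / cmod z"
  have c: "cmod c = 1" using \<open>z \<noteq> 0\<close> by (simp add: c_def norm_divide)
  from \<open>z \<noteq> 0\<close> have "c * z = cmod z"
    by (simp add: c_def complex_norm_square[symmetric] mult.commute power2_eq_square)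
  then have cz: "Re (c * z) = cmod z" by simp
  \<comment> \<open>The factor 1/4 balances gain and cost: the mean over \<open>T\<close> grows by
    more than 1/8, and the exponential moment by a factor of at most
    \<open>exp ((1/4)^2) = exp (1/16)\<close>.\<close>
  define u where "u = (\<lambda>x. Re (c * chi s x) / 4)"
  define \<Phi>' where "\<Phi>' = (\<lambda>x. \<Phi> x + u x)"
  have "avg T u = Re (c * z) / 4"
    unfolding u_def z_def avg_cmult[symmetric] avg_Re[symmetric]
    using avg_cmult[of T "1/4" "\<lambda>x. Re (c * chi s x)"] by simp
  then have 1: "Suc m / 8 \<le> avg T \<Phi>'"
    using avgT z cz by (simp add: \<Phi>'_def avg_add)
  \<comment> \<open>Shifts by multiples of \<open>v\<close> leave \<open>\<Phi>\<close> fixed, so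
    averaging over them acts on \<open>u\<close> alone.\<close>
  have inv_shift: "avg (carrier G) (\<lambda>x. exp (\<Phi>' x))
    = avg (carrier G) (\<lambda>x. exp (\<Phi> x) * exp (u (x \<oplus>\<^bsub>G\<^esub> (a \<odot>\<^bsub>G\<^esub> v))))" if a: "a \<in> carrier F" for a
  proof -
    have av: "a \<odot>\<^bsub>G\<^esub> v \<in> V" using a v SG by (simp add: V perp_smult)
    have avG: "a \<odot>\<^bsub>G\<^esub> v \<in> carrier G" using a vG by simp
    have "avg (carrier G) (\<lambda>x. exp (\<Phi>' x)) = avg (carrier G) (\<lambda>x. exp (\<Phi>' (x \<oplus>\<^bsub>G\<^esub> (a \<odot>\<^bsub>G\<^esub> v))))"
      by (rule G.avg_translate[OF avG, symmetric])
    also have "\<dots> = avg (carrier G) (\<lambda>x. exp (\<Phi> x) * exp (u (x \<oplus>\<^bsub>G\<^esub> (a \<odot>\<^bsub>G\<^esub> v))))"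
      by (intro avg_cong) (simp add: \<Phi>'_def inv av exp_add)
    finally show ?thesis .
  qed
  have F0: "finite (carrier F)" "carrier F \<noteq> {}" using zero_closed by auto
  have small: "avg (carrier F) (\<lambda>a. exp (u (x \<oplus>\<^bsub>G\<^esub> (a \<odot>\<^bsub>G\<^esub> v)))) \<le> exp (1/16)"
    if x: "x \<in> carrier G" for x
  proof -
    have u_eq: "u (x \<oplus>\<^bsub>G\<^esub> (a \<odot>\<^bsub>G\<^esub> v)) = Re (c * chi s x / 4 * \<psi> (a \<otimes> dot s v))" if "a \<in> carrier F" for a
      using that x vG sG by (simp add: u_def chi_add) (simp add: chi_def dot_smult algebra_simps)
    have "avg (carrier F) (\<lambda>a. exp (u (x \<oplus>\<^bsub>G\<^esub> (a \<odot>\<^bsub>G\<^esub> v)))) \<le> exp ((1/4)\<^sup>2)"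
    proof (rule avg_exp_le[OF F0])
      have "avg (carrier F) (\<lambda>a. u (x \<oplus>\<^bsub>G\<^esub> (a \<odot>\<^bsub>G\<^esub> v)))
        = avg (carrier F) (\<lambda>a. Re (c * chi s x / 4 * \<psi> (a \<otimes> dot s v)))"
        by (intro avg_cong u_eq)
      also have "\<dots> = 0"
        unfolding avg_Re avg_cmult using b vG sG by (simp add: avg_psi_mult)
      finally show "avg (carrier F) (\<lambda>a. u (x \<oplus>\<^bsub>G\<^esub> (a \<odot>\<^bsub>G\<^esub> v))) = 0" .
      fix a assume a: "a \<in> carrier F"
      have "\<bar>u (x \<oplus>\<^bsub>G\<^esub> (a \<odot>\<^bsub>G\<^esub> v))\<bar> \<le> cmod (c * chi s x / 4 * \<psi> (a \<otimes> dot s v))"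
        unfolding u_eq[OF a] by (rule abs_Re_le_cmod)
      also have "\<dots> = 1/4" using a x vG sG c by (simp add: norm_mult norm_divide)
      finally show "\<bar>u (x \<oplus>\<^bsub>G\<^esub> (a \<odot>\<^bsub>G\<^esub> v))\<bar> \<le> 1/4" .
    qed simp
    then show ?thesis by (simp add: power2_eq_square)
  qed
  have "avg (carrier G) (\<lambda>x. exp (\<Phi>' x)) = avg (carrier F) (\<lambda>a. avg (carrier G) (\<lambda>x. exp (\<Phi>' x)))"
    using F0 by (simp add: avg_const)
  also have "\<dots> = avg (carrier F) (\<lambda>a. avg (carrier G) (\<lambda>x. exp (\<Phi> x) * exp (u (x \<oplus>\<^bsub>G\<^esub> (a \<odot>\<^bsub>G\<^esub> v)))))"
    by (intro avg_cong inv_shift)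
  also have "\<dots> = avg (carrier G) (\<lambda>x. exp (\<Phi> x) * avg (carrier F) (\<lambda>a. exp (u (x \<oplus>\<^bsub>G\<^esub> (a \<odot>\<^bsub>G\<^esub> v)))))"
    by (subst avg_swap) (simp add: avg_cmult)
  also have "\<dots> \<le> avg (carrier G) (\<lambda>x. exp (1/16) * exp (\<Phi> x))"
    by (intro avg_mono) (simp add: small mult.commute)
  also have "\<dots> \<le> exp (1/16) * exp (m / 16)"
    unfolding avg_cmult using avgG by (intro mult_left_mono) auto
  also have "\<dots> = exp (Suc m / 16)"
    by (simp add: exp_add[symmetric] add_divide_distrib)
  finally have 2: "avg (carrier G) (\<lambda>x. exp (\<Phi>' x)) \<le> exp (Suc m / 16)" .
  have 3: "N \<le> card (perp (insert s S)) * card (carrier F) ^ Suc m"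
  proof -
    have "N \<le> card (perp S) * card (carrier F) ^ m" using cardV by (simp add: V)
    also have "\<dots> \<le> (card (perp (insert s S)) * card (carrier F)) * card (carrier F) ^ m"
      using card_perp_insert[OF SG sG] by (rule mult_right_mono) simp
    finally show ?thesis by (simp add: mult.assoc)
  qed
  have 4: "\<Phi>' (x \<oplus>\<^bsub>G\<^esub> w) = \<Phi>' x" if "x \<in> carrier G" "w \<in> perp (insert s S)" for x w
  proof -
    have "w \<in> V" "w \<in> carrier G" "dot s w = \<zero>" using that by (auto simp: V perp_def)
    then show ?thesis using that(1) sG inv by (simp add: \<Phi>'_def u_def chi_add) (simp add: chi_def)
  qed
  show ?thesis
    unfolding spec_flag_def
    by (intro exI[of _ "perp (insert s S)"] exI[of _ "insert s S"] exI[of _ \<Phi>'] conjI ballI)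
      (use S s 1 2 3 4 in auto)
qed

text \<open>Flags have bounded length by \<open>spec_flag_bound\<close>, so a longest one exists. By
  \<open>spec_flag_Suc\<close> its subspace is the annihilator of the whole spectrum, whose
  codimension is therefore at most the length.\<close>

lemma card_perp_spec:
  assumes T: "T \<subseteq> carrier G" "T \<noteq> {}"
  shows "\<exists>m. real m \<le> 16 * ln (N / card T) \<and> N \<le> card (perp (spec T)) * card (carrier F) ^ m"
proof -
  define P where "P = (\<lambda>m. \<exists>V. spec_flag T m V)"
  have bound: "m \<le> nat \<lfloor>16 * ln (N / card T)\<rfloor>" if "P m" for m
    using that spec_flag_bound[OF T] by (auto simp: P_def le_nat_floor)
  have "P 0" using spec_flag_0 by (auto simp: P_def)
  then have "P (Greatest P)" using bound by (rule GreatestI_nat)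
  moreover have "\<not> P (Suc (Greatest P))"
    using Greatest_le_nat[of P "Suc (Greatest P)", OF _ bound] by auto
  ultimately obtain m V where V: "spec_flag T m V" "\<not> (\<exists>V. spec_flag T (Suc m) V)"
    unfolding P_def by blast
  then have "V = perp (spec T)" using spec_flag_Suc by blast
  then show ?thesis using V spec_flag_bound[OF T V(1)] by (auto simp: spec_flag_def)
qed

end

section \<open>Subspaces of prescribed dimension\<close>

lemma (in vectorspace) card_span_le:
  assumes K: "finite (carrier K)" and B: "finite B" "B \<subseteq> carrier V"
  shows "card (span B) \<le> card (carrier K) ^ card B"
proof -
  have fin: "finite (B \<rightarrow>\<^sub>E carrier K)" using K B by (intro finite_PiE)
  have "span B \<subseteq> (\<lambda>a. lincomb a B) ` (B \<rightarrow>\<^sub>E carrier K)"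
  proof
    fix v assume "v \<in> span B"
    then obtain a where a: "a \<in> B \<rightarrow> carrier K" "v = lincomb a B"
      using finite_span[OF B] by auto
    then have "v = lincomb (restrict a B) B"
      by (auto intro!: lincomb_restrict B)
    then show "v \<in> (\<lambda>a. lincomb a B) ` (B \<rightarrow>\<^sub>E carrier K)" using a(1) by auto
  qed
  then have "card (span B) \<le> card ((\<lambda>a. lincomb a B) ` (B \<rightarrow>\<^sub>E carrier K))"
    using fin by (intro card_mono) auto
  also have "\<dots> \<le> card (carrier K) ^ card B"
    using card_image_le[OF fin] B by (simp add: card_PiE)
  finally show ?thesis .
qed

text \<open>A basis of \<open>P\<close> with \<open>r\<close> elements gives \<open>card P\<close>
  at most the \<open>r\<close>-th power of the field size, so \<open>d \<le> r\<close>; any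
  \<open>d\<close> of the basis vectors span a suitable \<open>W\<close>.\<close>

lemma (in vectorspace) ex_subspace_of_dim:
  assumes K: "finite (carrier K)" and P: "subspace K P V" "finite P"
    and card: "card (carrier K) ^ d \<le> card P"
  shows "\<exists>W \<subseteq> P. subspace K W V \<and> vectorspace.dim K (vs W) = d \<and> card W \<le> card (carrier K) ^ d"
proof -
  have subm: "submodule K P V" using P by simp
  have PV: "P \<subseteq> carrier V" using subm by (simp add: submodule_def)
  interpret P: vectorspace K "vs P" by (rule subspace_is_vs[OF P(1)])
  have "P.span P = P" using P.in_own_span[of P] P.span_is_subset2[of P] by auto
  then have "P.fin_dim" unfolding P.fin_dim_def using P(2) by auto
  then obtain \<beta> where \<beta>: "finite \<beta>" "P.basis \<beta>" using P.finite_basis_exists by blast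
  have \<beta>P: "\<beta> \<subseteq> P" and li: "P.lin_indpt \<beta>" and gen: "P.span \<beta> = P"
    using \<beta>(2) by (auto simp: P.basis_def)
  have "card (carrier K) ^ d \<le> card (carrier K) ^ card \<beta>"
    using P.card_span_le[OF K \<beta>(1)] \<beta>P card gen by simp
  moreover have "1 < card (carrier K)"
  proof -
    have "card {\<zero>\<^bsub>K\<^esub>, \<one>\<^bsub>K\<^esub>} \<le> card (carrier K)" using K by (intro card_mono) auto
    then show ?thesis by simp
  qed
  ultimately have "d \<le> card \<beta>" by (simp add: power_increasing_iff)
  then obtain b where b: "b \<subseteq> \<beta>" "card b = d" "finite b"
    by (rule obtain_subset_with_card_n)
  have bP: "b \<subseteq> P" using b \<beta>P by auto
  then have bV: "b \<subseteq> carrier V" using PV by auto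
  have "P.lin_indpt b" using li b(1) by (rule P.subset_li_is_li)
  then have lib: "lin_indpt b" using span_li_not_depend(2)[OF bP subm] by simp
  define W where "W = span b"
  have WP: "W \<subseteq> P" unfolding W_def by (rule span_is_subset[OF bP subm])
  have subW: "subspace K W V" unfolding W_def by (rule span_is_subspace[OF bV])
  then have submW: "submodule K W V" by simp
  have bW: "b \<subseteq> W" unfolding W_def by (rule in_own_span[OF bV])
  interpret W: vectorspace K "vs W" by (rule subspace_is_vs[OF subW])
  have "W.basis b"
    unfolding W.basis_def using bW lib span_li_not_depend[OF bW submW] by (simp add: W_def)
  then have "W.dim = d" using W.dim_basis b by simp
  moreover have "card W \<le> card (carrier K) ^ d"
    unfolding W_def using card_span_le[OF K b(3) bV] b(2) by simp
  ultimately show ?thesis using WP subW by blast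
qed

section \<open>The sumset\<close>

context finite_field_space
begin

lemma card_field_ge_2: "2 \<le> card (carrier F)"
proof -
  have "card {\<zero>, \<one>} \<le> card (carrier F)" by (intro card_mono) auto
  then show ?thesis by simp
qed

text \<open>The sizes of \<open>A \<inter> (t - C)\<close> sum to \<open>card A * card C\<close>
  over all \<open>t\<close>, so some \<open>t\<close> attains the mean.\<close>

lemma popular_translate:
  assumes A: "A \<subseteq> carrier G" and C: "C \<subseteq> carrier G"
  shows "\<exists>t\<in>carrier G. card A * card C \<le> N * card {a \<in> A. t \<ominus>\<^bsub>G\<^esub> a \<in> C}"
proof (rule ccontr)
  assume "\<not> ?thesis"
  then have less: "N * card {a \<in> A. t \<ominus>\<^bsub>G\<^esub> a \<in> C} < card A * card C" if "t \<in> carrier G" for t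
    using that by force
  have finA: "finite A" using A G.finite_carrier by (rule finite_subset)
  have fib: "card {t \<in> carrier G. t \<ominus>\<^bsub>G\<^esub> a \<in> C} = card C" if "a \<in> A" for a
    by (rule bij_betw_same_card[where f = "\<lambda>t. t \<ominus>\<^bsub>G\<^esub> a"], rule bij_betwI[where g = "\<lambda>c. c \<oplus>\<^bsub>G\<^esub> a"])
      (use that A C in \<open>auto simp: a_minus_def G.a_assoc G.l_neg G.r_neg subset_iff\<close>)
  have "(\<Sum>t\<in>carrier G. card {a \<in> A. t \<ominus>\<^bsub>G\<^esub> a \<in> C}) = (\<Sum>a\<in>A. card {t \<in> carrier G. t \<ominus>\<^bsub>G\<^esub> a \<in> C})"
    using sum_multicount_gen[OF G.finite_carrier finA, of "\<lambda>t a. t \<ominus>\<^bsub>G\<^esub> a \<in> C"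
      "\<lambda>a. card {t \<in> carrier G. t \<ominus>\<^bsub>G\<^esub> a \<in> C}"] by simp
  also have "\<dots> = card A * card C" by (simp add: fib)
  finally have "N * (\<Sum>t\<in>carrier G. card {a \<in> A. t \<ominus>\<^bsub>G\<^esub> a \<in> C}) = N * (card A * card C)" by simp
  moreover have "(\<Sum>t\<in>carrier G. N * card {a \<in> A. t \<ominus>\<^bsub>G\<^esub> a \<in> C}) < (\<Sum>t\<in>carrier G. card A * card C)"
    using less by (intro sum_strict_mono) auto
  ultimately show False by (simp add: sum_distrib_left)
qed

text \<open>To be applied with \<open>A \<inter> (t - C)\<close> for \<open>A\<close> and
  \<open>B + C\<close> for \<open>S\<close>. The bound on \<open>l\<close> gives pointwise
  invariance up to 1/4, \<open>d\<close> leaves room for dimension \<open>d\<close> in the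
  annihilator, and \<open>cardB\<close> makes the union bound over \<open>W\<close>
  affordable.\<close>

lemma translates_covered:
  fixes k l d :: nat
  assumes A: "A \<subseteq> carrier G" "A \<noteq> {}" and B: "B \<subseteq> carrier G" and t: "t \<in> carrier G"
    and S: "\<And>x a. x \<in> B \<Longrightarrow> a \<in> A \<Longrightarrow> x \<oplus>\<^bsub>G\<^esub> t \<ominus>\<^bsub>G\<^esub> a \<in> S"
    and k: "0 < k" and l: "0 < l" "64 * real N \<le> 4 ^ l * card A"
    and d: "16 * (k * ln (N / card A) + ln 2) + d \<le> n"
    and cardB: "400 * real (card (carrier F)) ^ d * N * exp (- (k / (256 * (real l)\<^sup>2))) \<le> card B"
  shows "\<exists>X W. X \<subseteq> B \<and> 0.99 * real (card B) \<le> card X \<and> VectorSpace.subspace F W G \<and>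
    vectorspace.dim F (G\<lparr>carrier := W\<rparr>) = d \<and>
    (\<forall>x\<in>X. \<forall>w\<in>W. \<exists>a\<in>A. x \<oplus>\<^bsub>G\<^esub> t \<oplus>\<^bsub>G\<^esub> w \<ominus>\<^bsub>G\<^esub> a \<in> S)"
proof -
  have finA: "finite A" using A(1) G.finite_carrier by (rule finite_subset)
  have A0: "0 < card A" using A finA by (simp add: card_gt_0_iff)
  have finB: "finite B" using B G.finite_carrier by (rule finite_subset)
  define g where "g = (\<lambda>x. of_bool (x \<in> S) :: real)"
  have g01: "0 \<le> g x" "g x \<le> 1" "\<bar>g x\<bar> \<le> 1" for x by (auto simp: g_def)
  define f where "f = (\<lambda>x. avg A (\<lambda>a. g (x \<ominus>\<^bsub>G\<^esub> a)))"
  \<comment> \<open>The minimiser of \<open>\<mu>^2 / k - \<mu> / (8 * l)\<close>, the exponent in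
    the bound for \<open>E\<close>; the minimum is \<open>- k / (256 * l^2)\<close>.\<close>
  define \<mu> where "\<mu> = real k / (16 * l)"
  have "real k / (16 * l) \<le> real k / 1" using l(1) by (intro divide_left_mono) auto
  then have \<mu>: "0 \<le> \<mu>" "\<mu> \<le> k" by (auto simp: \<mu>_def)
  have "\<exists>T \<subseteq> carrier G. T \<noteq> {} \<and> (card A / N) ^ k * N \<le> 2 * real (card T) \<and>
    (\<forall>t\<in>T. G.exp_mean (\<mu> / 2) (\<lambda>x. f (x \<oplus>\<^bsub>G\<^esub> t) - f x) \<le> 4 * exp (\<mu>\<^sup>2 / k))"
    unfolding f_def by (rule G.almost_periods[OF A g01(1,2) \<mu> k])
  then obtain T where T: "T \<subseteq> carrier G" "T \<noteq> {}"
    and cardT: "(card A / N) ^ k * N \<le> 2 * real (card T)"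
    and periods: "\<And>t. t \<in> T \<Longrightarrow> G.exp_mean (\<mu> / 2) (\<lambda>x. f (x \<oplus>\<^bsub>G\<^esub> t) - f x) \<le> 4 * exp (\<mu>\<^sup>2 / k)"
    by blast
  have finT: "finite T" using T(1) G.finite_carrier by (rule finite_subset)
  define Fl where "Fl = (G.smooth T ^^ l) f"
  define E where "E = {x \<in> carrier G. 1/4 < \<bar>Fl x - f x\<bar>}"
  have "G.exp_mean (\<mu> / 2 / l) (\<lambda>x. Fl x - f x) \<le> 4 * exp (\<mu>\<^sup>2 / k)"
    unfolding Fl_def using \<mu> l(1) periods by (intro G.exp_mean_smooth_pow_diff_le T) auto
  then have "real (card E) \<le> 4 * exp (\<mu>\<^sup>2 / k) * exp (- (\<mu> / 2 / l) * (1/4)) * N"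
    unfolding E_def using \<mu> by (intro G.card_exceed_le) auto
  also have "4 * exp (\<mu>\<^sup>2 / k) * exp (- (\<mu> / 2 / l) * (1/4)) = 4 * exp (- (k / (256 * (real l)\<^sup>2)))"
  proof -
    have "\<mu>\<^sup>2 / k + - (\<mu> / 2 / l) * (1/4) = - (k / (256 * (real l)\<^sup>2))"
      using k l(1) by (simp add: \<mu>_def power2_eq_square field_simps)
    then show ?thesis by (simp only: mult.assoc exp_add[symmetric])
  qed
  finally have cardE: "real (card E) \<le> 4 * exp (- (k / (256 * (real l)\<^sup>2))) * N" .
  obtain m where m: "real m \<le> 16 * ln (N / card T)"
    and cardP: "N \<le> card (perp (spec T)) * card (carrier F) ^ m"
    using card_perp_spec[OF T] by blast
  have q: "2 \<le> card (carrier F)" by (rule card_field_ge_2)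
  have N0: "0 < real N" using G.card_carrier_pos by simp
  have T0: "0 < real (card T)" using T finT by (simp add: card_gt_0_iff)
  \<comment> \<open>The almost periods have density at least half the \<open>k\<close>-th power of
    the density of \<open>A\<close>; with \<open>d\<close> this bounds the codimension
    \<open>m\<close> by \<open>n - d\<close>.\<close>
  have "ln (N / card T) \<le> k * ln (N / card A) + ln 2"
  proof -
    have "real N * real (card A) ^ k \<le> 2 * real (card T) * real N ^ k"
      using cardT N0 by (simp add: power_divide field_simps)
    then have "N / card T \<le> (N / card A) ^ k * 2"
      using A0 T0 by (simp add: power_divide field_simps)
    then have "ln (N / card T) \<le> ln ((N / card A) ^ k * 2)"
      using N0 T0 by (subst ln_le_cancel_iff) (auto simp: A0)
    also have "\<dots> = k * ln (N / card A) + ln 2"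
      using N0 A0 by (simp add: ln_mult ln_realpow)
    finally show ?thesis .
  qed
  then have "16 * ln (N / card T) \<le> 16 * (k * ln (N / card A) + ln 2)"
    by (rule mult_left_mono) simp
  with m have "m \<le> 16 * (k * ln (N / card A) + ln 2)" by (rule order.trans)
  then have "real m + real d \<le> 16 * (k * ln (N / card A) + ln 2) + d" by (rule add_right_mono)
  also note d
  finally have "real m + real d \<le> n" .
  then have "m + d \<le> n" by linarith
  then have "card (carrier F) ^ d * card (carrier F) ^ m \<le> N"
    using q by (simp add: card_coord power_add[symmetric] add.commute)
  then have "card (carrier F) ^ d * card (carrier F) ^ m \<le> card (perp (spec T)) * card (carrier F) ^ m"
    using cardP by linarith
  then have "card (carrier F) ^ d \<le> card (perp (spec T))"
    using q by simp
  moreover have "spec T \<subseteq> carrier G" by (auto simp: spec_def)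
  moreover have finP: "finite (perp (spec T))"
    by (rule finite_subset[OF _ G.finite_carrier]) (auto simp: perp_def)
  ultimately obtain W where W: "W \<subseteq> perp (spec T)" and subW: "VectorSpace.subspace F W G"
    and dimW: "vectorspace.dim F (G\<lparr>carrier := W\<rparr>) = d" and cardW: "card W \<le> card (carrier F) ^ d"
    using V.ex_subspace_of_dim[OF finite_field perp_subspace finP] by blast
  have finW: "finite W" using W finP by (rule finite_subset)
  have WG: "w \<in> carrier G" if "w \<in> W" for w using that W by (auto simp: perp_def)
  have zW: "\<zero>\<^bsub>G\<^esub> \<in> W" using subW by (simp add: VectorSpace.subspace_def submodule_def)
  \<comment> \<open>Points whose whole coset \<open>x + t + W\<close> avoids the exceptional set;
    each \<open>w\<close> excludes at most \<open>card E\<close> of them. As \<open>0\<close> lies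
    in \<open>W\<close>, also \<open>x + t\<close> avoids \<open>E\<close>.\<close>
  define X where "X = {x \<in> B. \<forall>w\<in>W. x \<oplus>\<^bsub>G\<^esub> t \<oplus>\<^bsub>G\<^esub> w \<notin> E}"
  have "card B \<le> card X + card (B - X)"
    using card_Un_le[of X "B - X"] by (simp add: X_def Un_absorb1)
  moreover have "card (B - X) \<le> card W * card E"
  proof -
    have "B - X = (\<Union>w\<in>W. {x \<in> B. x \<oplus>\<^bsub>G\<^esub> t \<oplus>\<^bsub>G\<^esub> w \<in> E})" by (auto simp: X_def)
    then have "card (B - X) \<le> (\<Sum>w\<in>W. card {x \<in> B. x \<oplus>\<^bsub>G\<^esub> t \<oplus>\<^bsub>G\<^esub> w \<in> E})"
      using card_UN_le[OF finW] by simp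
    also have "\<dots> \<le> (\<Sum>w\<in>W. card E)"
    proof (rule sum_mono)
      fix w assume w: "w \<in> W"
      show "card {x \<in> B. x \<oplus>\<^bsub>G\<^esub> t \<oplus>\<^bsub>G\<^esub> w \<in> E} \<le> card E"
        by (rule card_inj_on_le[where f = "\<lambda>x. x \<oplus>\<^bsub>G\<^esub> t \<oplus>\<^bsub>G\<^esub> w"])
          (use B t WG[OF w] in \<open>auto simp: inj_on_def E_def subset_iff\<close>)
    qed
    finally show ?thesis by simp
  qed
  ultimately have "real (card B) \<le> card X + real (card W) * real (card E)"
    by (metis (no_types, opaque_lifting) add_left_mono le_trans of_nat_add of_nat_le_iff of_nat_mult)
  moreover have "real (card W) * real (card E)
    \<le> real (card (carrier F)) ^ d * (4 * exp (- (k / (256 * (real l)\<^sup>2))) * N)"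
    using cardE cardW by (intro mult_mono) (auto simp: of_nat_power[symmetric] simp del: of_nat_power)
  \<comment> \<open>The 400 in \<open>cardB\<close> is the 4 in the bound for \<open>E\<close> times
    100, so at most one hundredth of \<open>B\<close> is lost.\<close>
  ultimately have cardX: "0.99 * real (card B) \<le> card X"
    using cardB by (simp add: mult_ac)
  have "\<exists>a\<in>A. x \<oplus>\<^bsub>G\<^esub> t \<oplus>\<^bsub>G\<^esub> w \<ominus>\<^bsub>G\<^esub> a \<in> S" if x: "x \<in> X" and w: "w \<in> W" for x w
  proof -
    let ?y = "x \<oplus>\<^bsub>G\<^esub> t"
    have xB: "x \<in> B" using x by (simp add: X_def)
    have y: "?y \<in> carrier G" using xB B t by auto
    have "f ?y = avg A (\<lambda>a. 1)"
      unfolding f_def using S[OF xB] by (intro avg_cong) (simp add: g_def)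
    then have "f ?y = 1" using finA A by (simp add: avg_const)
    moreover have "?y \<notin> E"
      using x zW y by (auto simp: X_def)
    then have "\<bar>Fl ?y - f ?y\<bar> \<le> 1/4" using y by (simp add: E_def)
    moreover have "\<bar>Fl (?y \<oplus>\<^bsub>G\<^esub> w) - f (?y \<oplus>\<^bsub>G\<^esub> w)\<bar> \<le> 1/4"
      using x w y WG[OF w] by (auto simp: X_def E_def)
    moreover have "\<bar>Fl (?y \<oplus>\<^bsub>G\<^esub> w) - Fl ?y\<bar> \<le> 1/4"
      unfolding Fl_def f_def using W w
      by (intro smooth_pow_convolution_invariant A T y l g01) auto
    \<comment> \<open>Starting from \<open>f = 1\<close> at \<open>x + t\<close>, three errors of at
      most 1/4 leave at least 1/4.\<close>
    ultimately have "0 < f (?y \<oplus>\<^bsub>G\<^esub> w)" by linarith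
    moreover have "f (?y \<oplus>\<^bsub>G\<^esub> w) = avg A (\<lambda>a. 0)" if "\<not> ?thesis"
      unfolding f_def using that by (intro avg_cong) (simp add: g_def)
    ultimately show ?thesis by (auto simp: avg_def)
  qed
  then show ?thesis
    using cardX subW dimW by (intro exI[of _ X] exI[of _ W]) (auto simp: X_def)
qed

end

section \<open>Choice of the parameters \<open>k\<close> and \<open>l\<close>\<close>

lemma ln2_ge_half: "1/2 \<le> ln (2 :: real)"
  using ln_le_minus_one[of "1/2 :: real"] by (simp add: ln_div)

text \<open>\<open>k\<close> is the largest value keeping the codimension cost
  \<open>16 * k * L\<close> within \<open>n / 2\<close>, up to rounding, and \<open>l\<close> is
  just large enough for \<open>4^l\<close> to beat the density loss. The assumption \<open>y\<close>
  forces \<open>n / L^3 \<ge> 10^9 / 2\<close>, so rounding costs only constants: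
  \<open>k \<ge> n / (64 * L)\<close> and \<open>l \<le> 9 * L\<close>.\<close>

lemma parameter_choice:
  fixes L :: real and n :: nat
  assumes L: "ln 2 \<le> L" and y: "ln 2 \<le> 1/10^9 * n / L ^ 3"
  defines "k \<equiv> nat \<lfloor>n / (32 * L)\<rfloor>" and "l \<equiv> nat \<lceil>7 * L\<rceil>"
  shows "0 < k" "0 < l" "7 * L \<le> l" "16 * (k * L) \<le> n / 2"
    "1/10^9 * n / L ^ 3 + ln 400 \<le> k / (256 * (real l)\<^sup>2)"
proof -
  have L12: "1/2 \<le> L" using L ln2_ge_half by linarith
  define y where "y = n / L ^ 3"
  have y_ge: "1/2 * 10^9 \<le> y" using y ln2_ge_half by (simp add: y_def)
  have n_eq: "real n = y * L ^ 3" using L12 by (simp add: y_def)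
  have nL: "n / (32 * L) = y * L\<^sup>2 / 32"
    using L12 by (simp add: n_eq power3_eq_cube power2_eq_square)
  have "(1/2 :: real)\<^sup>2 \<le> L\<^sup>2" using L12 by (intro power_mono) auto
  then have "(1/2 * 10^9) * (1/2)\<^sup>2 \<le> y * L\<^sup>2" using y_ge by (intro mult_mono) auto
  then have big: "2 \<le> n / (32 * L)" unfolding nL by (simp add: power2_eq_square)
  have k_ge: "n / (32 * L) - 1 \<le> k" and k_le: "k \<le> n / (32 * L)"
    using big unfolding k_def by linarith+
  have k_ge': "n / (64 * L) \<le> k" using big k_ge L12 by (simp add: field_simps)
  show "0 < k" using big k_ge by linarith
  show l0: "0 < l" using L12 unfolding l_def by linarith
  show l_ge: "7 * L \<le> l" unfolding l_def by linarith
  show "16 * (k * L) \<le> n / 2" using k_le L12 by (simp add: field_simps)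
  have l_le: "l \<le> 9 * L" using L12 unfolding l_def by linarith
  have "ln (400::real) = 2 * ln 20"
    using ln_mult[of 20 20] by simp
  then have "ln (400::real) \<le> 38" using ln_le_minus_one[of 20] by simp
  then have "1/10^9 * y + ln 400 \<le> y / (64 * 256 * 81)" using y_ge by simp
  also have "\<dots> = (n / (64 * L)) / (256 * (9 * L)\<^sup>2)"
    using L12 by (simp add: n_eq power3_eq_cube power2_eq_square)
  also have "\<dots> \<le> k / (256 * (real l)\<^sup>2)"
    using k_ge' l_le l0 L12 by (intro frac_le mult_left_mono power_mono) auto
  finally show "1/10^9 * n / L ^ 3 + ln 400 \<le> k / (256 * (real l)\<^sup>2)"
    by (simp add: y_def)
qed

context finite_field_space
begin

section \<open>The sumset bound with an explicit constant\<close>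

lemma zero_subspace: "VectorSpace.subspace F {\<zero>\<^bsub>G\<^esub>} G"
  using V.span_is_subspace[of "{}"] by (simp add: V.span_empty)

lemma triple_sumset:
  assumes A: "A \<subseteq> carrier G" "A \<noteq> {}" and B: "B \<subseteq> carrier G" "B \<noteq> {}"
    and C: "C \<subseteq> carrier G" "C \<noteq> {}"
  defines "\<alpha> \<equiv> set_density F n A" and "\<beta> \<equiv> set_density F n B" and "\<gamma> \<equiv> set_density F n C"
  defines "e \<equiv> (1/10^9 * real n / ln (2 / (\<alpha> * \<gamma>)) ^ 3 - ln (1 / \<beta>)) / ln (real (card (carrier F)))"
  shows "\<exists>X U d. X \<subseteq> B \<and> 0.99 * real (card B) \<le> real (card X) \<and>
    affine_subspace_of_dim F G d U \<and> \<lfloor>e\<rfloor> \<le> int d \<and>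
    X <+>\<^bsub>G\<^esub> U \<subseteq> A <+>\<^bsub>G\<^esub> B <+>\<^bsub>G\<^esub> C"
proof (cases "1 \<le> e")
  case False
  \<comment> \<open>Here \<open>\<lfloor>e\<rfloor> \<le> 0\<close>, so \<open>X = B\<close> and the
    single point \<open>a + c\<close> suffice.\<close>
  obtain a c where ac: "a \<in> A" "c \<in> C" using A C by blast
  then have acG: "a \<in> carrier G" "c \<in> carrier G" using A C by auto
  obtain W where W: "W \<subseteq> {\<zero>\<^bsub>G\<^esub>}" "VectorSpace.subspace F W G"
    "vectorspace.dim F (G\<lparr>carrier := W\<rparr>) = 0"
    using V.ex_subspace_of_dim[OF finite_field zero_subspace, of 0] by auto
  have "affine_subspace_of_dim F G 0 (W +>\<^bsub>G\<^esub> (a \<oplus>\<^bsub>G\<^esub> c))"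
    unfolding affine_subspace_of_dim_def using W acG by blast
  moreover have "\<lfloor>e\<rfloor> \<le> int 0" using False by linarith
  moreover have "B <+>\<^bsub>G\<^esub> (W +>\<^bsub>G\<^esub> (a \<oplus>\<^bsub>G\<^esub> c)) \<subseteq> A <+>\<^bsub>G\<^esub> B <+>\<^bsub>G\<^esub> C"
  proof
    fix y assume "y \<in> B <+>\<^bsub>G\<^esub> (W +>\<^bsub>G\<^esub> (a \<oplus>\<^bsub>G\<^esub> c))"
    then obtain x where x: "x \<in> B" "y = x \<oplus>\<^bsub>G\<^esub> (\<zero>\<^bsub>G\<^esub> \<oplus>\<^bsub>G\<^esub> (a \<oplus>\<^bsub>G\<^esub> c))"
      using W(1) by (auto simp: set_add_def' a_r_coset_def')
    then have "y = a \<oplus>\<^bsub>G\<^esub> x \<oplus>\<^bsub>G\<^esub> c" using acG B by (auto simp: G.a_ac subset_iff)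
    then show "y \<in> A <+>\<^bsub>G\<^esub> B <+>\<^bsub>G\<^esub> C" using x ac by (auto simp: set_add_def')
  qed
  moreover have "0.99 * real (card B) \<le> real (card B)" by simp
  ultimately show ?thesis by blast
next
  case True
  have N0: "0 < real N" using G.card_carrier_pos by simp
  have q: "2 \<le> card (carrier F)" by (rule card_field_ge_2)
  have fin: "finite A" "finite B" "finite C" using A B C by (auto intro: finite_subset)
  have dens: "set_density F n D = card D / N" for D by (simp add: set_density_def card_coord)
  have "0 < set_density F n D \<and> set_density F n D \<le> 1" if "D \<subseteq> carrier G" "D \<noteq> {}" for D
    using that N0 card_mono[OF G.finite_carrier that(1)] finite_subset[OF that(1) G.finite_carrier]
    by (simp add: dens card_gt_0_iff)
  then have \<alpha>: "0 < \<alpha>" "\<alpha> \<le> 1" and \<beta>: "0 < \<beta>" "\<beta> \<le> 1" and \<gamma>: "0 < \<gamma>" "\<gamma> \<le> 1"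
    using A B C by (auto simp: \<alpha>_def \<beta>_def \<gamma>_def)
  have \<alpha>\<gamma>: "0 < \<alpha> * \<gamma>" "\<alpha> * \<gamma> \<le> 1" using \<alpha> \<gamma> by (auto simp: mult_le_one)
  define L where "L = ln (2 / (\<alpha> * \<gamma>))"
  have L_ge: "ln 2 \<le> L" unfolding L_def using \<alpha>\<gamma> by (subst ln_le_cancel_iff) (auto simp: field_simps)
  have expL: "exp L = 2 / (\<alpha> * \<gamma>)" unfolding L_def using \<alpha>\<gamma> by simp
  have lnq: "ln 2 \<le> ln (real (card (carrier F)))" using q by simp
  then have lnq_half: "1/2 \<le> ln (real (card (carrier F)))" using ln2_ge_half by linarith
  have e_eq: "e * ln (real (card (carrier F))) = 1/10^9 * real n / L ^ 3 - ln (1 / \<beta>)"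
    using lnq_half by (simp add: e_def L_def)
  have ln\<beta>: "0 \<le> ln (1 / \<beta>)" using \<beta> by simp
  \<comment> \<open>From \<open>e \<ge> 1\<close> the main term is at least
    \<open>ln q \<ge> ln 2\<close>; this is the largeness of \<open>n\<close> on which
    \<open>parameter_choice\<close> rests.\<close>
  have "1 * ln (real (card (carrier F))) \<le> e * ln (real (card (carrier F)))"
    using True lnq_half by (intro mult_right_mono) auto
  then have y: "ln 2 \<le> 1/10^9 * real n / L ^ 3" using e_eq ln\<beta> lnq by linarith
  define k where "k = nat \<lfloor>n / (32 * L)\<rfloor>"
  define l where "l = nat \<lceil>7 * L\<rceil>"
  note kl = parameter_choice[OF L_ge y, folded k_def l_def]
  define d where "d = nat \<lfloor>e\<rfloor>"
  have d_le: "d \<le> e" using True by (simp add: d_def)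
  then have d_ln: "d * ln (real (card (carrier F))) \<le> 1/10^9 * real n / L ^ 3 - ln (1 / \<beta>)"
    unfolding e_eq[symmetric] using lnq_half by (intro mult_right_mono) auto
  obtain t where t: "t \<in> carrier G" "card A * card C \<le> N * card {a \<in> A. t \<ominus>\<^bsub>G\<^esub> a \<in> C}"
    using popular_translate[OF A(1) C(1)] by blast
  define A' where "A' = {a \<in> A. t \<ominus>\<^bsub>G\<^esub> a \<in> C}"
  have A': "A' \<subseteq> carrier G" using A by (auto simp: A'_def)
  have dens_A': "\<alpha> * \<gamma> * N \<le> card A'"
  proof -
    have "real (card A * card C) \<le> real (N * card A')" using t(2) unfolding A'_def of_nat_le_iff .
    then show ?thesis using N0 by (simp add: \<alpha>_def \<gamma>_def dens field_simps)
  qed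
  then have A'0: "0 < real (card A')" using \<alpha>\<gamma> N0 by (smt (verit) mult_pos_pos)
  then have A'_ne: "A' \<noteq> {}" by auto
  \<comment> \<open>As \<open>ln 4 \<ge> 1\<close> and \<open>l \<ge> 7 * L\<close>, the power
    \<open>4^l\<close> is at least \<open>exp L ^ 7\<close>. Six factors, each at least 2, give 64;
    the seventh is \<open>2 / (\<alpha> * \<gamma>)\<close>.\<close>
  have 1: "64 * real N \<le> 4 ^ l * card A'"
  proof -
    have "exp (7 * L) \<le> exp (l * ln 4)"
    proof -
      have "ln (4::real) = 2 * ln 2" using ln_mult[of 2 2] by simp
      then have "real l * 1 \<le> l * ln (4::real)" using ln2_ge_half by (intro mult_left_mono) auto
      then show ?thesis using kl(3) by simp
    qed
    also have "\<dots> = 4 ^ l" by (simp add: exp_of_nat_mult)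
    finally have "exp (7 * L) \<le> 4 ^ l" .
    moreover have "exp (7 * L) = exp L ^ 6 * exp L"
      using exp_of_nat_mult[of 7 L] by (simp add: numeral_eq_Suc)
    moreover have "64 * exp L \<le> exp L ^ 6 * exp L"
    proof -
      have "2 \<le> exp L" unfolding expL using \<alpha>\<gamma> by (simp add: field_simps)
      then have "2 ^ 6 \<le> exp L ^ 6" by (rule power_mono) simp
      then show ?thesis by (intro mult_right_mono) auto
    qed
    ultimately have "64 * exp L \<le> 4 ^ l" by linarith
    then have "128 \<le> 4 ^ l * (\<alpha> * \<gamma>)" using \<alpha>\<gamma> by (simp add: expL field_simps)
    then have "128 * real N \<le> 4 ^ l * (\<alpha> * \<gamma>) * N" using N0 by (intro mult_right_mono) auto
    also have "\<dots> \<le> 4 ^ l * card A'"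
      using mult_left_mono[OF dens_A', of "4 ^ l"] by (simp add: mult.assoc)
    finally show ?thesis using N0 by simp
  qed
  have 2: "16 * (k * ln (N / card A') + ln 2) + d \<le> n"
  proof -
    have "N / card A' \<le> 1 / (\<alpha> * \<gamma>)" using dens_A' A'0 \<alpha>\<gamma> by (simp add: field_simps)
    then have "ln (N / card A') \<le> ln (1 / (\<alpha> * \<gamma>))"
      using N0 A'0 \<alpha>\<gamma> by (subst ln_le_cancel_iff) auto
    also have "\<dots> = L - ln 2" unfolding L_def using \<alpha> \<gamma> by (simp add: ln_div)
    finally have "k * ln (N / card A') \<le> k * (L - ln 2)" by (rule mult_left_mono) simp
    \<comment> \<open>The 2 inside the logarithm \<open>L\<close> leaves a slack of
      \<open>k * ln 2\<close>, which absorbs the extra \<open>ln 2\<close> since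
      \<open>k \<ge> 1\<close>.\<close>
    moreover have "1 * ln 2 \<le> k * ln (2::real)" using kl(1) by (intro mult_right_mono) auto
    ultimately have "k * ln (N / card A') + ln 2 \<le> k * L"
      unfolding right_diff_distrib by linarith
    then have "16 * (k * ln (N / card A') + ln 2) \<le> 16 * (k * L)"
      by (rule mult_left_mono) simp
    \<comment> \<open>With \<open>L\<close> and \<open>ln q\<close> both at least 1/2,
      \<open>d\<close> is at most \<open>16 * n / 10^9\<close>.\<close>
    moreover have "d \<le> real n / 2"
    proof -
      have "d * (1/2) \<le> d * ln (real (card (carrier F)))" using lnq_half by (intro mult_left_mono) auto
      also have "\<dots> \<le> 1/10^9 * real n / L ^ 3" using d_ln ln\<beta> by linarith
      also have "\<dots> \<le> 1/10^9 * real n / (1/2) ^ 3"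
        using L_ge ln2_ge_half by (intro divide_left_mono power_mono mult_pos_pos) auto
      finally show ?thesis by (simp add: power3_eq_cube)
    qed
    ultimately show ?thesis using kl(4) by linarith
  qed
  \<comment> \<open>After taking logarithms this is the bound \<open>d_ln\<close> added to the last
    estimate of \<open>parameter_choice\<close>.\<close>
  have 3: "400 * real (card (carrier F)) ^ d * N * exp (- (k / (256 * (real l)\<^sup>2))) \<le> card B"
  proof -
    have "real (card (carrier F)) ^ d = exp (d * ln (real (card (carrier F))))"
      using q by (simp add: exp_of_nat_mult)
    then have "400 * real (card (carrier F)) ^ d * exp (- (k / (256 * (real l)\<^sup>2)))
      = exp (ln 400 + d * ln (real (card (carrier F))) - k / (256 * (real l)\<^sup>2))"
      by (simp add: exp_add exp_diff exp_minus field_simps)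
    also have "\<dots> \<le> exp (ln \<beta>)"
    proof -
      have "ln (1 / \<beta>) = - ln \<beta>" using \<beta> by (simp add: ln_div)
      then show ?thesis unfolding exp_le_cancel_iff using d_ln kl(5) by linarith
    qed
    also have "\<dots> = card B / N" using \<beta> by (simp add: \<beta>_def dens)
    finally show ?thesis using N0 by (simp add: field_simps)
  qed
  have S: "x \<oplus>\<^bsub>G\<^esub> t \<ominus>\<^bsub>G\<^esub> a \<in> B <+>\<^bsub>G\<^esub> C" if "x \<in> B" "a \<in> A'" for x a
  proof -
    have "x \<oplus>\<^bsub>G\<^esub> t \<ominus>\<^bsub>G\<^esub> a = x \<oplus>\<^bsub>G\<^esub> (t \<ominus>\<^bsub>G\<^esub> a)"
      using that B A' t by (auto simp: a_minus_def G.a_assoc subset_iff)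
    then show ?thesis using that by (auto simp: set_add_def' A'_def)
  qed
  obtain X W where X: "X \<subseteq> B" "0.99 * real (card B) \<le> card X"
    and W: "VectorSpace.subspace F W G" "vectorspace.dim F (G\<lparr>carrier := W\<rparr>) = d"
    and XW: "\<And>x w. x \<in> X \<Longrightarrow> w \<in> W \<Longrightarrow> \<exists>a\<in>A'. x \<oplus>\<^bsub>G\<^esub> t \<oplus>\<^bsub>G\<^esub> w \<ominus>\<^bsub>G\<^esub> a \<in> B <+>\<^bsub>G\<^esub> C"
    using translates_covered[OF A' A'_ne B(1) t(1) S kl(1,2) 1 2 3] by blast
  have WG: "W \<subseteq> carrier G" using W(1) by (simp add: VectorSpace.subspace_def submodule_def)
  \<comment> \<open>The shift \<open>t\<close> goes into the affine subspace, so that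
    \<open>X\<close> remains a subset of \<open>B\<close>.\<close>
  have "affine_subspace_of_dim F G d (W +>\<^bsub>G\<^esub> t)"
    unfolding affine_subspace_of_dim_def using W t by blast
  moreover have "\<lfloor>e\<rfloor> \<le> int d" by (simp add: d_def)
  moreover have "X <+>\<^bsub>G\<^esub> (W +>\<^bsub>G\<^esub> t) \<subseteq> A <+>\<^bsub>G\<^esub> B <+>\<^bsub>G\<^esub> C"
  proof
    fix y assume "y \<in> X <+>\<^bsub>G\<^esub> (W +>\<^bsub>G\<^esub> t)"
    then obtain x w where xw: "x \<in> X" "w \<in> W" "y = x \<oplus>\<^bsub>G\<^esub> (w \<oplus>\<^bsub>G\<^esub> t)"
      by (auto simp: set_add_def' a_r_coset_def')
    have xwG: "x \<in> carrier G" "w \<in> carrier G" using xw X B WG by auto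
    obtain a where a: "a \<in> A'" "x \<oplus>\<^bsub>G\<^esub> t \<oplus>\<^bsub>G\<^esub> w \<ominus>\<^bsub>G\<^esub> a \<in> B <+>\<^bsub>G\<^esub> C" using XW[OF xw(1,2)] by blast
    then obtain b c where bc: "b \<in> B" "c \<in> C" "x \<oplus>\<^bsub>G\<^esub> t \<oplus>\<^bsub>G\<^esub> w \<ominus>\<^bsub>G\<^esub> a = b \<oplus>\<^bsub>G\<^esub> c"
      by (auto simp: set_add_def')
    have aG: "a \<in> carrier G" "a \<in> A" using a(1) A' by (auto simp: A'_def)
    have bcG: "b \<in> carrier G" "c \<in> carrier G" using bc B C by auto
    have "y = (x \<oplus>\<^bsub>G\<^esub> t \<oplus>\<^bsub>G\<^esub> w \<ominus>\<^bsub>G\<^esub> a) \<oplus>\<^bsub>G\<^esub> a"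
      using xw(3) xwG t(1) aG by (simp add: a_minus_def G.a_assoc G.l_neg) (simp add: G.a_ac)
    also have "\<dots> = a \<oplus>\<^bsub>G\<^esub> b \<oplus>\<^bsub>G\<^esub> c"
      unfolding bc(3) using aG bcG by (simp add: G.a_ac)
    finally show "y \<in> A <+>\<^bsub>G\<^esub> B <+>\<^bsub>G\<^esub> C" using aG bc by (auto simp: set_add_def')
  qed
  ultimately show ?thesis using X by blast
qed

end

theorem theorem8p5:
  shows "\<exists>c::real. c > 0 \<and>
    (\<forall>(q::nat) (n::nat) (F :: nat ring) A B C (\<alpha>::real) (\<beta>::real) (\<gamma>::real).
       primepow q \<and> field F \<and> card (carrier F) = q \<and>
       A \<subseteq> carrier (coord_space F n) \<and> A \<noteq> {} \<and> \<alpha> = set_density F n A \<and>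
       B \<subseteq> carrier (coord_space F n) \<and> B \<noteq> {} \<and> \<beta> = set_density F n B \<and>
       C \<subseteq> carrier (coord_space F n) \<and> C \<noteq> {} \<and> \<gamma> = set_density F n C \<longrightarrow>
       (\<exists>X V d.
          X \<subseteq> B \<and> real (card X) \<ge> 0.99 * real (card B) \<and>
          affine_subspace_of_dim F (coord_space F n) d V \<and>
          int d \<ge> \<lfloor>(c * real n / (ln (2 / (\<alpha> * \<gamma>))) ^ 3 - ln (1 / \<beta>)) / ln (real q)\<rfloor> \<and>
          X <+>\<^bsub>coord_space F n\<^esub> V
            \<subseteq> A <+>\<^bsub>coord_space F n\<^esub> B <+>\<^bsub>coord_space F n\<^esub> C))"
proof (rule exI[of _ "1/10^9"], intro conjI allI impI, goal_cases)
  case (2 q n F A B C \<alpha> \<beta> \<gamma>)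
  then have F: "field F" and q: "card (carrier F) = q" "primepow q" by auto
  \<comment> \<open>An infinite set has \<open>card\<close> 0, so the prime power cardinality forces
    finiteness.\<close>
  have fin: "finite (carrier F)" using q primepow_gt_Suc_0[of q] by (intro card_ge_0_finite) simp
  obtain \<psi> :: "nat \<Rightarrow> complex" where "\<forall>x\<in>carrier F. \<forall>y\<in>carrier F. \<psi> (x \<oplus>\<^bsub>F\<^esub> y) = \<psi> x * \<psi> y"
    "\<forall>x\<in>carrier F. cmod (\<psi> x) = 1" "\<exists>x\<in>carrier F. \<psi> x \<noteq> 1"
    using field.exists_additive_character[OF F fin] by blast
  then have "finite_field_space F \<psi>"
    using F fin by (simp add: finite_field_space_def finite_field_space_axioms_def)
  then show ?case
    using finite_field_space.triple_sumset[of F \<psi> A n B C] 2 by simp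
qed simp

end
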